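(* Let $\tau\in(0,\infty)$, let $\mu_1,\mu_2$ be non-negative Borel measures on $\mathbb{R}^+=[0,\infty)$ with $$M:=\mu_1([0,\tau])+\mu_2([0,\infty))\in(0,\infty),$$ let $f\in C(\mathbb{R}^+;(0,\infty))$ be locally Lipschitz continuous, and suppose there exists $\phi\in\mathcal{S}$ such that $f(x)\sim\phi(x)$ as $x\to\infty$. Let $\psi\in C([-\tau,0];(0,\infty))$. Put $F(x)=\int_1^x \frac{du}{f(u)}$ for $x>0$. Then the unique continuous solution $x$ of $$x'(t)=\int_{[0,\tau]}\mu_1(ds)f(x(t-s))+\int_{[0,t]}\mu_2(ds)f(x(t-s)),\quad t>0;\qquad x(t)=\psi(t),\ t\in[-\tau,0],$$ obeys $$\lim_{t\to\infty}x(t)=\infty,\qquad \lim_{t\to\infty}\frac{F(x(t))}{Mt}=1.$$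
   Context: $\mathcal{S}$ is the class of functions $\phi\in C^1((0,\infty);(0,\infty))\cap C(\mathbb{R}^+;(0,\infty))$ with $\phi'(x)>0$ for all $x>0$ and $\lim_{x\to\infty}\phi'(x)=0$. The notation $f(x)\sim\phi(x)$ as $x\to\infty$ means $\lim_{x\to\infty}f(x)/\phi(x)=1$. A solution is a continuous function on $[-\tau,\infty)$, locally absolutely continuous on $[0,\infty)$, equal to $\psi$ on $[-\tau,0]$ and satisfying the differential equation for almost every $t>0$. *)

theory Defs
  imports "HOL-Analysis.Analysis"
begin

definition class_S :: "(real \<Rightarrow> real) set" where
  "class_S = {\<phi>. continuous_on {0..} \<phi> \<and> (\<forall>x\<ge>0. \<phi> x > 0) \<and>
     (\<exists>\<phi>'. (\<forall>x>0. (\<phi> has_real_derivative \<phi>' x) (at x)) \<and> continuous_on {0<..} \<phi>' \<and>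
           (\<forall>x>0. \<phi>' x > 0) \<and> (\<phi>' \<longlongrightarrow> 0) at_top)}"

(* The finite set P collects the endpoint pairs (u, v) of pairwise disjoint open
   subintervals of [a, b]. The library constant absolutely_continuous is about measures. *)
definition abs_cont_on_interval :: "real \<Rightarrow> real \<Rightarrow> (real \<Rightarrow> real) \<Rightarrow> bool" where
  "abs_cont_on_interval a b g \<longleftrightarrow>
     (\<forall>\<epsilon>>0. \<exists>\<delta>>0. \<forall>P::(real \<times> real) set.
        finite P \<and> (\<forall>(u, v)\<in>P. a \<le> u \<and> u < v \<and> v \<le> b) \<and>
        pairwise (\<lambda>p q. disjnt {fst p<..<snd p} {fst q<..<snd q}) P \<and>
        (\<Sum>(u, v)\<in>P. v - u) < \<delta>
        \<longrightarrow> (\<Sum>(u, v)\<in>P. \<bar>g v - g u\<bar>) < \<epsilon>)"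

definition locally_abs_cont_nonneg :: "(real \<Rightarrow> real) \<Rightarrow> bool" where
  "locally_abs_cont_nonneg g \<longleftrightarrow> (\<forall>b\<ge>0. abs_cont_on_interval 0 b g)"

definition delay_rhs ::
  "real \<Rightarrow> real measure \<Rightarrow> real measure \<Rightarrow> (real \<Rightarrow> real) \<Rightarrow> (real \<Rightarrow> real) \<Rightarrow> real \<Rightarrow> real" where
  "delay_rhs \<tau> \<mu>1 \<mu>2 f x t =
     (LINT s:{0..\<tau>}|\<mu>1. f (x (t - s))) + (LINT s:{0..t}|\<mu>2. f (x (t - s)))"

(* Only the values of x on [-\<tau>, \<infinity>) matter. Since f is a function on [0, \<infinity>), a solution
   has to take values there for f (x (t - s)) to make sense; hence the condition x t \<ge> 0. *)
definition is_solution ::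
  "real \<Rightarrow> real measure \<Rightarrow> real measure \<Rightarrow> (real \<Rightarrow> real) \<Rightarrow> (real \<Rightarrow> real) \<Rightarrow> (real \<Rightarrow> real) \<Rightarrow> bool" where
  "is_solution \<tau> \<mu>1 \<mu>2 f \<psi> x \<longleftrightarrow>
     continuous_on {-\<tau>..} x \<and> (\<forall>t\<ge>-\<tau>. x t \<ge> 0) \<and>
     locally_abs_cont_nonneg x \<and>
     (\<forall>t\<in>{-\<tau>..0}. x t = \<psi> t) \<and>
     (AE t in lborel. t > 0 \<longrightarrow> (x has_real_derivative delay_rhs \<tau> \<mu>1 \<mu>2 f x t) (at t))"

(* The interval integral is oriented, so F_int f x is negative for 0 < x < 1. *)
definition F_int :: "(real \<Rightarrow> real) \<Rightarrow> real \<Rightarrow> real" where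
  "F_int f x = (LBINT u=1..x. 1 / f u)"

end

theory Submission
  imports Defs
begin

text \<open>
  Existence and uniqueness come from Picard iteration in a norm with exponential weight; since \<open>f\<close> is
  dominated by a linear function, the iterates stay below an exponential, so the local Lipschitz
  condition suffices. An absolutely continuous function is the integral of its almost everywhere
  derivative, which makes every solution a fixed point of the Picard operator.

  As \<open>f\<close> is bounded below by a positive constant, \<open>x\<close> tends to infinity. Since \<open>x\<close> is nondecreasing and
  \<open>f = O(\<phi>)\<close>, we have \<open>x' = O(\<phi> (x t))\<close>; by the mean value theorem and \<open>\<phi>' \<longlonglongrightarrow> 0\<close> this gives
  \<open>\<phi> (x (t - s)) / \<phi> (x t) \<longlonglongrightarrow> 1\<close> for each fixed delay \<open>s\<close>. Dominated convergence then yields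
  \<open>x' t / f (x t) \<longlonglongrightarrow> M\<close>, and averaging this limit over \<open>[0, t]\<close> gives the asymptotics of \<open>F (x t)\<close>.
\<close>

section \<open>Absolutely continuous functions\<close>

text \<open>The cut-off at \<open>t\<close> in the second integral lets each atom of the second
  measure enter at a single instant, so the right-hand side may jump and a solution need not be
  continuously differentiable. It is still Lipschitz on bounded intervals of nonnegative times, with
  known derivative off a countable set. Hence the integral theorem below is needed twice: for an
  arbitrary solution, of which only absolute continuity is known, and for \<open>F (x t)\<close>.
  Since \<open>f\<close> need not be monotone or differentiable, its values at different times are
  compared through \<phi>, which is increasing and admits the mean value theorem; both quotients of
  \<open>f\<close> and \<phi> are bounded on the half-line and tend to 1, so bounds and limits pass
  from one function to the other. Delays under the second measure can be arbitrarily large, so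
  \<open>f (x (t - s))\<close> need not be close to \<open>f (x t)\<close> uniformly in
  \<open>s\<close>; a constant majorant, integrable because the total mass is finite, takes the
  place of uniformity.\<close>

text \<open>Off the null set the derivative controls the increments. Intervals tagged in the null set are kept
  inside an open set of small measure by the gauge, so there absolute continuity controls them.\<close>

lemma abs_cont_has_integral:
  fixes g g' :: "real \<Rightarrow> real"
  assumes ab: "a \<le> b" and ac: "abs_cont_on_interval a b g" and N: "negligible N"
    and der: "\<And>t. t \<in> {a..b} - N \<Longrightarrow> (g has_real_derivative g' t) (at t within {a..b})"
  shows "(g' has_integral (g b - g a)) {a..b}"
proof (cases "a = b")
  case True
  then show ?thesis by (simp add: has_integral_refl)
next
  case False
  with ab have "a < b" by simp
  \<comment> \<open>The value 0 on the null set makes every piece tagged there contribute only its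
    increment of \<open>g\<close>; a spike argument restores \<open>g'\<close> at the end.\<close>
  define h where "h = (\<lambda>t. if t \<in> N then 0 else g' t)"
  have "(h has_integral (g b - g a)) {a..b}"
    unfolding has_integral_factor_content_real
  proof (intro allI impI)
    fix e :: real assume "e > 0"
    \<comment> \<open>The allowed error \<open>e * (b - a)\<close> is shared equally between the
      pieces tagged in \<open>N\<close> and the remaining ones.\<close>
    then have "e / 2 * (b - a) > 0" using \<open>a < b\<close> by simp
    with ac[unfolded abs_cont_on_interval_def] obtain \<delta> where "\<delta> > 0" and
      \<delta>: "\<And>P::(real \<times> real) set. \<lbrakk>finite P; \<And>u v. (u, v) \<in> P \<Longrightarrow> a \<le> u \<and> u < v \<and> v \<le> b;
         pairwise (\<lambda>p q. disjnt {fst p<..<snd p} {fst q<..<snd q}) P; (\<Sum>(u, v)\<in>P. v - u) < \<delta>\<rbrakk>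
        \<Longrightarrow> (\<Sum>(u, v)\<in>P. \<bar>g v - g u\<bar>) < e / 2 * (b - a)"
      by (smt (verit, best) case_prodI2)
    obtain U where U: "open U" "N \<subseteq> U" "U - N \<in> lmeasurable" "emeasure lebesgue (U - N) < ennreal \<delta>"
      using sets_lebesgue_outer_open[OF negligible_imp_sets[OF N] \<open>\<delta> > 0\<close>] by metis
    have Um: "emeasure lebesgue U < ennreal \<delta>"
    proof -
      have "emeasure lebesgue ((U - N) \<union> N) = emeasure lebesgue (U - N)"
        using U(3) N by (intro emeasure_Un_null_set) (auto simp: negligible_iff_null_sets fmeasurable_def)
      moreover have "(U - N) \<union> N = U" using U by auto
      ultimately show ?thesis using U by simp
    qed
    have "\<exists>d>0. \<forall>y\<in>{a..b}. \<bar>y - t\<bar> < d \<longrightarrow> \<bar>g y - g t - g' t * (y - t)\<bar> \<le> e / 2 * \<bar>y - t\<bar>"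
      if t: "t \<in> {a..b} - N" for t
    proof -
      have "(g has_derivative (*) (g' t)) (at t within {a..b})"
        using der[OF t] by (simp add: has_field_derivative_def)
      then show ?thesis using \<open>e > 0\<close> unfolding has_derivative_within_alt
        by (metis half_gt_zero real_norm_def)
    qed
    then obtain d where d: "\<And>t. t \<in> {a..b} - N \<Longrightarrow> d t > 0"
      "\<And>t y. t \<in> {a..b} - N \<Longrightarrow> y \<in> {a..b} \<Longrightarrow> \<bar>y - t\<bar> < d t
         \<Longrightarrow> \<bar>g y - g t - g' t * (y - t)\<bar> \<le> e / 2 * \<bar>y - t\<bar>"
      by metis
    define \<gamma> where "\<gamma> t = (if t \<in> N then U else if t \<in> {a..b} then ball t (d t) else UNIV)" for t
    have gauge: "gauge \<gamma>"
      using U d by (auto simp: gauge_def \<gamma>_def)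
    have close: "norm ((\<Sum>(x, k)\<in>p. measure lborel k *\<^sub>R h x) - (g b - g a)) \<le> e * measure lborel {a..b}"
      if p: "p tagged_division_of {a..b}" and fine: "\<gamma> fine p" for p
    proof -
      define D where "D = (\<lambda>k. g (Sup k) - g (Inf k))"
      have fin: "finite p" using p by auto
      have tag: "\<exists>u v. k = {u..v} \<and> a \<le> u \<and> u \<le> x \<and> x \<le> v \<and> v \<le> b" if "(x, k) \<in> p" for x k
        using tagged_division_ofD(2-4)[OF p that] by (metis atLeastAtMost_iff atLeastatMost_subset_iff box_real(2) order_trans)
      \<comment> \<open>Absolute continuity is stated for nondegenerate intervals, whereas a tagged
        division may contain single points; these carry neither increment nor length.\<close>
      have nz: "Inf k < Sup k \<or> D k = 0 \<and> measure lborel k = 0" if xkp: "(x, k) \<in> p" for x k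
      proof -
        obtain u v where "k = {u..v}" "u \<le> v" using tag[OF xkp] by force
        then show ?thesis by (cases "u = v") (auto simp: D_def)
      qed
      define q where "q = {(x, k) \<in> p. x \<in> N \<and> Inf k < Sup k}"
      define P where "P = (\<lambda>(x, k). (Inf k, Sup k)) ` q"
      have finq: "finite q" using fin by (rule finite_subset[rotated]) (auto simp: q_def)
      have sep: "{Inf k<..<Sup k} \<inter> {Inf k'<..<Sup k'} = {}"
        if "(x, k) \<in> p" "(x', k') \<in> p" "(x, k) \<noteq> (x', k')" for x k x' k'
        using tagged_division_ofD(5)[OF p that] tag[OF that(1)] tag[OF that(2)] by auto
      \<comment> \<open>\<open>P\<close> keeps only the endpoints of a tagged piece. Disjoint
        nonempty interiors prevent two pieces of \<open>q\<close> from merging in \<open>P\<close>,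
        so no increment is lost from the sum.\<close>
      have inj: "inj_on (\<lambda>(x, k). (Inf k, Sup k)) q"
      proof (rule inj_onI, clarify)
        fix x k x' k' assume "(x, k) \<in> q" "(x', k') \<in> q" "Inf k = Inf k'" "Sup k = Sup k'"
        then show "x = x' \<and> k = k'"
          using sep[of x k x' k'] by (auto simp: q_def greaterThanLessThan_empty_iff)
      qed
      have PP: "a \<le> u \<and> u < v \<and> v \<le> b" if "(u, v) \<in> P" for u v
        using that tag by (fastforce simp: P_def q_def)
      have PU: "{u<..<v} \<subseteq> U" if uv: "(u, v) \<in> P" for u v
      proof -
        obtain x k where xk: "(x, k) \<in> p" "x \<in> N" "u = Inf k" "v = Sup k"
          using uv by (auto simp: P_def q_def)
        then have "k \<subseteq> U" using fineD[OF fine xk(1)] by (simp add: \<gamma>_def)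
        then show ?thesis using tag[OF xk(1)] xk by auto
      qed
      have pw: "pairwise (\<lambda>p q. disjnt {fst p<..<snd p} {fst q<..<snd q}) P"
        using sep by (fastforce simp: pairwise_def disjnt_def P_def q_def)
      have "(\<Sum>(u, v)\<in>P. v - u) = (\<Sum>r\<in>P. measure lebesgue {fst r<..<snd r})"
        using PP by (intro sum.cong) (auto simp: less_imp_le)
      also have "\<dots> = measure lebesgue (\<Union>r\<in>P. {fst r<..<snd r})"
        proof (intro measure_finite_Union[symmetric])
        show "finite P" using finq by (simp add: P_def)
        show "disjoint_family_on (\<lambda>r. {fst r<..<snd r}) P"
          using pw unfolding pairwise_def disjnt_def disjoint_family_on_def by blast
        show "emeasure lebesgue {fst r<..<snd r} \<noteq> \<infinity>" if "r \<in> P" for r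
          using PP[of "fst r" "snd r"] that by (simp add: less_imp_le)
      qed auto
      also have "\<dots> \<le> measure lebesgue U"
      proof (rule measure_mono_fmeasurable)
        show "(\<Union>r\<in>P. {fst r<..<snd r}) \<subseteq> U" using PU by fastforce
        show "(\<Union>r\<in>P. {fst r<..<snd r}) \<in> sets lebesgue"
          by (intro sets_completionI_sets) (simp add: borel_open open_UN)
        show "U \<in> lmeasurable" using U(1) Um by (auto simp: fmeasurable_def intro: less_trans)
      qed
      also have "\<dots> < \<delta>"
        using Um \<open>\<delta> > 0\<close> by (metis emeasure_eq_ennreal_measure ennreal_less_iff measure_nonneg top.not_eq_extremum order_less_trans ennreal_less_top less_top)
      finally have "(\<Sum>(u, v)\<in>P. \<bar>g v - g u\<bar>) < e / 2 * (b - a)"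
        using \<delta>[OF _ PP pw] finq by (auto simp: P_def)
      moreover have "(\<Sum>(u, v)\<in>P. \<bar>g v - g u\<bar>) = (\<Sum>(x, k)\<in>q. \<bar>D k\<bar>)"
        unfolding P_def by (subst sum.reindex[OF inj]) (auto simp: D_def intro!: sum.cong)
      moreover have "(\<Sum>(x, k)\<in>q. \<bar>D k\<bar>) = (\<Sum>(x, k)\<in>{(x, k)\<in>p. x \<in> N}. \<bar>D k\<bar>)"
        using fin by (intro sum.mono_neutral_left) (auto simp: q_def dest: nz intro: finite_subset[OF _ fin])
      ultimately have 1: "(\<Sum>(x, k)\<in>{(x, k)\<in>p. x \<in> N}. \<bar>D k\<bar>) \<le> e / 2 * (b - a)"
        by simp
      \<comment> \<open>The tag splits its piece in two; the linearisation errors at the endpoints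
        are bounded by multiples of \<open>x - u\<close> and \<open>v - x\<close>, which add up to
        the length.\<close>
      have est: "\<bar>measure lborel k * h x - D k\<bar> \<le> e / 2 * measure lborel k" if xk: "(x, k) \<in> p" "x \<notin> N" for x k
      proof -
        obtain u v where k: "k = {u..v}" "a \<le> u" "u \<le> x" "x \<le> v" "v \<le> b" using tag[OF xk(1)] by blast
        then have x: "x \<in> {a..b} - N" using xk by auto
        have "k \<subseteq> ball x (d x)" using fineD[OF fine xk(1)] x by (simp add: \<gamma>_def)
        then have "\<bar>u - x\<bar> < d x" "\<bar>v - x\<bar> < d x" using k by (force simp: dist_real_def subset_iff)+
        then have "\<bar>g u - g x - g' x * (u - x)\<bar> \<le> e / 2 * (x - u)" "\<bar>g v - g x - g' x * (v - x)\<bar> \<le> e / 2 * (v - x)"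
          using d(2)[OF x, of u] d(2)[OF x, of v] k by auto
        then have "\<bar>(g u - g x - g' x * (u - x)) - (g v - g x - g' x * (v - x))\<bar> \<le> e / 2 * (x - u) + e / 2 * (v - x)"
          by (rule order_trans[OF abs_triangle_ineq4 add_mono])
        also have "\<dots> = e / 2 * measure lborel k" using k by (simp add: field_simps)
        also have "(g u - g x - g' x * (u - x)) - (g v - g x - g' x * (v - x)) = measure lborel k * h x - D k"
          using k xk by (simp add: D_def h_def algebra_simps)
        finally show ?thesis .
      qed
      have "(\<Sum>(x, k)\<in>{(x, k)\<in>p. x \<notin> N}. \<bar>measure lborel k * h x - D k\<bar>) \<le> (\<Sum>(x, k)\<in>{(x, k)\<in>p. x \<notin> N}. e / 2 * measure lborel k)"
        using est by (intro sum_mono) auto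
      also have "\<dots> \<le> (\<Sum>(x, k)\<in>p. e / 2 * measure lborel k)"
        using fin \<open>e > 0\<close> by (intro sum_mono2) auto
      also have "\<dots> = e / 2 * (b - a)"
        using additive_content_tagged_division[of p a b] p ab
        by (simp add: case_prod_unfold sum_distrib_left[symmetric] del: times_divide_eq_left times_divide_eq_right)
      finally have 2: "(\<Sum>(x, k)\<in>{(x, k)\<in>p. x \<notin> N}. \<bar>measure lborel k * h x - D k\<bar>) \<le> e / 2 * (b - a)" .
      have "(\<Sum>(x, k)\<in>p. measure lborel k *\<^sub>R h x) - (g b - g a) = (\<Sum>(x, k)\<in>p. measure lborel k * h x - D k)"
        using additive_tagged_division_1[OF ab p, of g]
        by (simp add: D_def case_prod_unfold sum_subtractf)
      also have "\<bar>\<dots>\<bar> \<le> (\<Sum>(x, k)\<in>p. \<bar>measure lborel k * h x - D k\<bar>)"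
        by (simp add: case_prod_unfold sum_abs)
      also have "\<dots> = (\<Sum>(x, k)\<in>{(x, k)\<in>p. x \<in> N}. \<bar>D k\<bar>)
          + (\<Sum>(x, k)\<in>{(x, k)\<in>p. x \<notin> N}. \<bar>measure lborel k * h x - D k\<bar>)"
      proof -
        have "(\<Sum>r\<in>p. \<bar>case r of (x, k) \<Rightarrow> measure lborel k * h x - D k\<bar>)
          = (\<Sum>r\<in>{(x, k)\<in>p. x \<in> N} \<union> {(x, k)\<in>p. x \<notin> N}. \<bar>case r of (x, k) \<Rightarrow> measure lborel k * h x - D k\<bar>)"
          by (rule sum.cong) auto
        also have "\<dots> = (\<Sum>r\<in>{(x, k)\<in>p. x \<in> N}. \<bar>case r of (x, k) \<Rightarrow> measure lborel k * h x - D k\<bar>)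
          + (\<Sum>r\<in>{(x, k)\<in>p. x \<notin> N}. \<bar>case r of (x, k) \<Rightarrow> measure lborel k * h x - D k\<bar>)"
          by (rule sum.union_disjoint) (auto intro: finite_subset[OF _ fin])
        also have "(\<Sum>r\<in>{(x, k)\<in>p. x \<in> N}. \<bar>case r of (x, k) \<Rightarrow> measure lborel k * h x - D k\<bar>)
          = (\<Sum>(x, k)\<in>{(x, k)\<in>p. x \<in> N}. \<bar>D k\<bar>)"
          by (intro sum.cong) (auto simp: h_def)
        finally show ?thesis by (simp add: case_prod_unfold)
      qed
      also have "\<dots> \<le> e * (b - a)" using 1 2 by (simp add: algebra_simps)
      finally show ?thesis using ab by simp
    qed
    show "\<exists>\<gamma>. gauge \<gamma> \<and> (\<forall>p. p tagged_division_of {a..b} \<and> \<gamma> fine p \<longrightarrow>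
        norm ((\<Sum>(x, k)\<in>p. measure lborel k *\<^sub>R h x) - (g b - g a)) \<le> e * measure lborel {a..b})"
      by (intro exI[of _ \<gamma>] conjI allI impI gauge close) (elim conjE, assumption)+
  qed
  then show ?thesis
    by (rule has_integral_spike[OF N, rotated]) (auto simp: h_def)
qed

lemma abs_cont_on_interval_lipschitz:
  assumes "L-lipschitz_on {a..b} g"
  shows "abs_cont_on_interval a b g"
  unfolding abs_cont_on_interval_def
proof (intro allI impI)
  fix e :: real assume "e > 0"
  have L: "L \<ge> 0" using assms by (rule lipschitz_on_nonneg)
  show "\<exists>\<delta>>0. \<forall>P::(real \<times> real) set.
        finite P \<and> (\<forall>(u, v)\<in>P. a \<le> u \<and> u < v \<and> v \<le> b) \<and>
        pairwise (\<lambda>p q. disjnt {fst p<..<snd p} {fst q<..<snd q}) P \<and>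
        (\<Sum>(u, v)\<in>P. v - u) < \<delta> \<longrightarrow> (\<Sum>(u, v)\<in>P. \<bar>g v - g u\<bar>) < e"
  \<comment> \<open>The \<open>+ 1\<close> keeps the denominator positive when
    \<open>L = 0\<close>.\<close>
  proof (intro exI[of _ "e / (L + 1)"] conjI allI impI)
    fix P :: "(real \<times> real) set"
    assume P: "finite P \<and> (\<forall>(u, v)\<in>P. a \<le> u \<and> u < v \<and> v \<le> b) \<and>
        pairwise (\<lambda>p q. disjnt {fst p<..<snd p} {fst q<..<snd q}) P \<and>
        (\<Sum>(u, v)\<in>P. v - u) < e / (L + 1)"
    have "(\<Sum>(u, v)\<in>P. \<bar>g v - g u\<bar>) \<le> (\<Sum>(u, v)\<in>P. (L + 1) * (v - u))"
    proof (intro sum_mono, clarify)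
      fix u v assume "(u, v) \<in> P"
      then have "a \<le> u" "u < v" "v \<le> b" using P by auto
      then show "\<bar>g v - g u\<bar> \<le> (L + 1) * (v - u)"
        using lipschitz_onD[OF assms, of v u] by (simp add: dist_real_def algebra_simps)
    qed
    also have "\<dots> = (L + 1) * (\<Sum>(u, v)\<in>P. v - u)"
      by (simp add: sum_distrib_left case_prod_unfold)
    also have "\<dots> < e" using P L by (simp add: field_simps)
    finally show "(\<Sum>(u, v)\<in>P. \<bar>g v - g u\<bar>) < e" .
  qed (use \<open>e > 0\<close> L in auto)
qed

section \<open>Bounds, continuity and an exponential integral\<close>

lemma continuous_bounded_Icc:
  fixes h :: "real \<Rightarrow> real"
  assumes "continuous_on UNIV h"
  shows "\<exists>B\<ge>0. \<forall>u\<in>{a..b}. \<bar>h u\<bar> \<le> B"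
proof -
  have "compact (h ` {a..b})"
    by (intro compact_continuous_image continuous_on_subset[OF assms]) auto
  then have "bounded (h ` {a..b})" by (rule compact_imp_bounded)
  then obtain B where "\<forall>y\<in>h ` {a..b}. norm y \<le> B" unfolding bounded_iff by blast
  then show ?thesis by (intro exI[of _ "max B 0"]) (auto simp: le_max_iff_disj)
qed

lemma continuous_on_UNIV_if_atMost:
  fixes x :: "real \<Rightarrow> real"
  assumes "\<And>b. continuous_on {..b} x"
  shows "continuous_on UNIV x"
proof (rule continuous_at_imp_continuous_on, rule ballI)
  fix t
  have "continuous_on {..<t+1} x" by (rule continuous_on_subset[OF assms[of "t+1"]]) auto
  then show "isCont x t" by (simp add: continuous_on_eq_continuous_at)
qed

text \<open>The factor \<open>c\<close> stays inside the integrand, so that \<open>c = 0\<close>,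
  which occurs when a Lipschitz constant vanishes, needs no separate case.\<close>

lemma exp_has_integral:
  fixes c t :: real
  assumes "0 \<le> t"
  shows "((\<lambda>s. c * exp (c * s)) has_integral exp (c * t) - 1) {0..t}"
proof -
  have "((\<lambda>s. c * exp (c * s)) has_integral exp (c * t) - exp (c * 0)) {0..t}"
    using assms
    by (intro fundamental_theorem_of_calculus)
      (auto intro!: derivative_eq_intros simp flip: has_real_derivative_iff_has_vector_derivative)
  then show ?thesis by simp
qed

section \<open>The delay operator\<close>

locale delay_kernel =
  fixes \<tau> :: real and \<nu>\<^sub>1 \<nu>\<^sub>2 :: "real measure"
  assumes tau: "0 < \<tau>"
    and fin1: "finite_measure \<nu>\<^sub>1" and fin2: "finite_measure \<nu>\<^sub>2"
    and sets1 [measurable_cong, simp]: "sets \<nu>\<^sub>1 = sets borel"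
    and sets2 [measurable_cong, simp]: "sets \<nu>\<^sub>2 = sets borel"
    and supp1: "AE s in \<nu>\<^sub>1. 0 \<le> s \<and> s \<le> \<tau>" and supp2: "AE s in \<nu>\<^sub>2. 0 \<le> s"
begin

sublocale \<nu>1: finite_measure \<nu>\<^sub>1 by (rule fin1)
sublocale \<nu>2: finite_measure \<nu>\<^sub>2 by (rule fin2)

lemma space1 [simp]: "space \<nu>\<^sub>1 = UNIV" using sets_eq_imp_space_eq[OF sets1] by simp
lemma space2 [simp]: "space \<nu>\<^sub>2 = UNIV" using sets_eq_imp_space_eq[OF sets2] by simp

definition mass :: real where "mass = measure \<nu>\<^sub>1 UNIV + measure \<nu>\<^sub>2 UNIV"

text \<open>The cut-off is \<open>{..t}\<close> and not \<open>{0..t}\<close> because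
  \<open>supp2\<close> already discards negative delays.\<close>

definition delay :: "(real \<Rightarrow> real) \<Rightarrow> real \<Rightarrow> real" where
  "delay h t = (LINT s|\<nu>\<^sub>1. h (t - s)) + (LINT s|\<nu>\<^sub>2. indicator {..t} s * h (t - s))"

lemma mass_nonneg: "0 \<le> mass"
  by (simp add: mass_def)

text \<open>Up to null sets, the delays that count satisfy \<open>0 \<le> s \<le> \<tau>\<close> in
  the first integral and \<open>0 \<le> s \<le> t\<close> in the second, so both see
  \<open>h\<close> only on \<open>{-\<tau>..t}\<close>. This supplies the constant majorant for
  integrability, for norm bounds and for dominated convergence.\<close>

lemma AE_delay_integrand_bounded:
  assumes "0 \<le> t" and "\<And>u. u \<in> {-\<tau>..t} \<Longrightarrow> \<bar>h u\<bar> \<le> B"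
  shows "AE s in \<nu>\<^sub>1. norm (h (t - s)) \<le> B" "AE s in \<nu>\<^sub>2. norm (indicator {..t} s * h (t - s)) \<le> B"
proof -
  have B: "0 \<le> B" using assms(2)[of 0] assms(1) tau by simp
  show "AE s in \<nu>\<^sub>1. norm (h (t - s)) \<le> B"
    using supp1 by eventually_elim (use assms in auto)
  show "AE s in \<nu>\<^sub>2. norm (indicator {..t} s * h (t - s)) \<le> B"
    using supp2 by eventually_elim (use assms B tau in \<open>auto simp: indicator_def\<close>)
qed

lemma integrable_delay:
  fixes h :: "real \<Rightarrow> real"
  assumes h: "continuous_on UNIV h" and t: "0 \<le> t"
  shows "integrable \<nu>\<^sub>1 (\<lambda>s. h (t - s))" "integrable \<nu>\<^sub>2 (\<lambda>s. indicator {..t} s * h (t - s))"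
proof -
  have [measurable]: "h \<in> borel_measurable borel" by (rule borel_measurable_continuous_onI[OF h])
  obtain B where B: "\<And>u. u \<in> {-\<tau>..t} \<Longrightarrow> \<bar>h u\<bar> \<le> B" using continuous_bounded_Icc[OF h] by blast
  show "integrable \<nu>\<^sub>1 (\<lambda>s. h (t - s))"
    by (rule \<nu>1.integrable_const_bound[OF AE_delay_integrand_bounded(1)[OF t B]]) auto
  show "integrable \<nu>\<^sub>2 (\<lambda>s. indicator {..t} s * h (t - s))"
    by (rule \<nu>2.integrable_const_bound[OF AE_delay_integrand_bounded(2)[OF t B]]) auto
qed

lemma delay_diff:
  assumes "continuous_on UNIV h" "continuous_on UNIV g" "0 \<le> t"
  shows "delay (\<lambda>u. h u - g u) t = delay h t - delay g t"
  using integrable_delay[OF assms(1,3)] integrable_delay[OF assms(2,3)]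
  by (simp add: delay_def right_diff_distrib)

lemma delay_bound:
  assumes h: "continuous_on UNIV h" and t: "0 \<le> t" and B: "\<And>u. u \<in> {-\<tau>..t} \<Longrightarrow> \<bar>h u\<bar> \<le> B"
  shows "\<bar>delay h t\<bar> \<le> mass * B"
proof -
  have "\<bar>LINT s|\<nu>\<^sub>1. h (t - s)\<bar> \<le> (LINT s|\<nu>\<^sub>1. B)"
    using integrable_delay(1)[OF h t] AE_delay_integrand_bounded(1)[OF t B]
    by (intro order_trans[OF integral_abs_bound] integral_mono_AE) auto
  moreover have "\<bar>LINT s|\<nu>\<^sub>2. indicator {..t} s * h (t - s)\<bar> \<le> (LINT s|\<nu>\<^sub>2. B)"
    using integrable_delay(2)[OF h t] AE_delay_integrand_bounded(2)[OF t B]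
    by (intro order_trans[OF integral_abs_bound] integral_mono_AE) auto
  ultimately show ?thesis by (simp add: delay_def mass_def algebra_simps)
qed

lemma delay_nonneg:
  assumes "\<And>u. 0 \<le> h u"
  shows "0 \<le> delay h t"
  unfolding delay_def using assms by (intro add_nonneg_nonneg integral_nonneg_AE) auto

lemma delay_measurable:
  assumes "continuous_on UNIV h"
  shows "delay h \<in> borel_measurable borel"
proof -
  have [measurable]: "h \<in> borel_measurable borel" by (rule borel_measurable_continuous_onI[OF assms])
  have "(\<lambda>t. LINT s|\<nu>\<^sub>1. h (t - s)) \<in> borel_measurable borel"
    by (rule \<nu>1.borel_measurable_lebesgue_integral) measurable
  \<comment> \<open>The indicator depends on \<open>t\<close> through its set; written as a
    conditional on \<open>s \<le> t\<close>, it is visibly measurable in both variables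
    jointly.\<close>
  moreover have "(\<lambda>t. LINT s|\<nu>\<^sub>2. (if s \<le> t then 1 else 0) * h (t - s)) \<in> borel_measurable borel"
    by (rule \<nu>2.borel_measurable_lebesgue_integral) measurable
  ultimately show ?thesis unfolding delay_def[abs_def]
    by (intro borel_measurable_add) (simp_all add: indicator_def)
qed

text \<open>Because \<open>delay h\<close> can jump, integrability comes from Borel measurability
  and a bound, not from continuity.\<close>

lemma delay_integrable_on:
  assumes h: "continuous_on UNIV h" and a: "0 \<le> a"
  shows "delay h integrable_on {a..b}"
proof -
  obtain B where B: "0 \<le> B" "\<And>u. u \<in> {-\<tau>..b} \<Longrightarrow> \<bar>h u\<bar> \<le> B" using continuous_bounded_Icc[OF h] by blast
  have "set_integrable lborel {a..b} (delay h)"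
  proof (rule set_integrable_bound)
    show "set_integrable lborel {a..b} (\<lambda>_. mass * B)"
      by (intro borel_integrable_atLeastAtMost' continuous_intros)
    show "set_borel_measurable lborel {a..b} (delay h)"
      using delay_measurable[OF h] unfolding set_borel_measurable_def by simp
    have "\<bar>delay h t\<bar> \<le> mass * B" if "t \<in> {a..b}" for t
      using that a by (intro delay_bound h B) auto
    then show "AE t in lborel. t \<in> {a..b} \<longrightarrow> norm (delay h t) \<le> norm (mass * B)"
      using B mass_nonneg by simp
  qed
  then show ?thesis by (rule set_borel_integral_eq_integral(1))
qed

text \<open>The kernel jumps only where \<open>\<nu>\<^sub>2\<close> has an atom, through the cut-off \<open>s \<le> t\<close>.\<close>

lemma delay_isCont:
  assumes h: "continuous_on UNIV h" and t: "0 < t" and atom: "measure \<nu>\<^sub>2 {t} = 0"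
  shows "isCont (delay h) t"
  unfolding continuous_at_sequentially comp_def
proof (intro allI impI)
  fix r :: "nat \<Rightarrow> real" assume r: "r \<longlonglongrightarrow> t"
  have [measurable]: "h \<in> borel_measurable borel" by (rule borel_measurable_continuous_onI[OF h])
  obtain B where B: "0 \<le> B" "\<And>u. u \<in> {-\<tau>..t+1} \<Longrightarrow> \<bar>h u\<bar> \<le> B" using continuous_bounded_Icc[OF h] by blast
  \<comment> \<open>Dropping the first \<open>N\<close> terms keeps all times between 0 and
    \<open>t + 1\<close>, the range on which the constant \<open>B\<close> is a majorant.\<close>
  have "\<forall>\<^sub>F n in sequentially. dist (r n) t < min t 1" using r t by (intro tendstoD) auto
  then obtain N where N: "\<And>n. n \<ge> N \<Longrightarrow> dist (r n) t < min t 1"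
    unfolding eventually_sequentially by blast
  have N': "0 \<le> r (n + N)" "r (n + N) \<le> t + 1" for n
    using N[of "n + N"] by (auto simp: dist_real_def)
  have rN: "(\<lambda>n. r (n + N)) \<longlonglongrightarrow> t" using r by (rule LIMSEQ_ignore_initial_segment)
  have hlim: "(\<lambda>n. h (r (n + N) - s)) \<longlonglongrightarrow> h (t - s)" for s
    using h rN by (intro isCont_tendsto_compose[of _ h]) (auto simp: continuous_on_eq_continuous_at intro!: tendsto_intros)
  have 1: "(\<lambda>n. LINT s|\<nu>\<^sub>1. h (r (n + N) - s)) \<longlonglongrightarrow> (LINT s|\<nu>\<^sub>1. h (t - s))"
  proof (rule integral_dominated_convergence[where w="\<lambda>_. B"])
    show "AE s in \<nu>\<^sub>1. norm (h (r (n + N) - s)) \<le> B" for n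
      using N'[of n] B by (intro AE_delay_integrand_bounded) auto
  qed (auto simp: hlim)
  have 2: "(\<lambda>n. LINT s|\<nu>\<^sub>2. indicator {..r (n + N)} s * h (r (n + N) - s))
      \<longlonglongrightarrow> (LINT s|\<nu>\<^sub>2. indicator {..t} s * h (t - s))"
  proof (rule integral_dominated_convergence[where w="\<lambda>_. B"])
    show "AE s in \<nu>\<^sub>2. norm (indicator {..r (n + N)} s * h (r (n + N) - s)) \<le> B" for n
      using N'[of n] B by (intro AE_delay_integrand_bounded) auto
    have "{t} \<in> null_sets \<nu>\<^sub>2"
      using atom by (simp add: null_sets_def \<nu>2.emeasure_eq_measure)
    then have "AE s in \<nu>\<^sub>2. s \<noteq> t" by (auto dest: AE_not_in)
    then show "AE s in \<nu>\<^sub>2. (\<lambda>n. indicator {..r (n + N)} s * h (r (n + N) - s)) \<longlonglongrightarrow> indicator {..t} s * h (t - s)"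
    proof eventually_elim
      case (elim s)
      \<comment> \<open>For \<open>s \<noteq> t\<close> the cut-off is eventually constant along the
        sequence; the point \<open>s = t\<close> is null by the hypothesis on the atom.\<close>
      have "\<forall>\<^sub>F n in sequentially. (s < r (n + N)) = (s < t) \<and> s \<noteq> r (n + N)"
      proof (cases "s < t")
        case True
        show ?thesis using order_tendstoD(1)[OF rN True] by eventually_elim (use True in auto)
      next
        case False
        then have "t < s" using elim by auto
        then show ?thesis using order_tendstoD(2)[OF rN, of s] by (auto elim!: eventually_mono)
      qed
      then have "\<forall>\<^sub>F n in sequentially. indicator {..r (n + N)} s = (indicator {..t} s :: real)"
        by eventually_elim (use elim in \<open>auto simp: indicator_def\<close>)
      then have "(\<lambda>n. indicator {..r (n + N)} s :: real) \<longlonglongrightarrow> indicator {..t} s"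
        by (rule tendsto_eventually)
      then show ?case using hlim by (intro tendsto_mult)
    qed
  qed auto
  show "(\<lambda>n. delay h (r n)) \<longlonglongrightarrow> delay h t"
    using tendsto_add[OF 1 2] unfolding delay_def by (rule LIMSEQ_offset)
qed

text \<open>For continuous \<open>h\<close> these are the only positive times at which
  \<open>delay h\<close> can jump. There are countably many, since the measure is finite.\<close>

definition atoms :: "real set" where "atoms = {t. measure \<nu>\<^sub>2 {t} \<noteq> 0}"

lemma negligible_atoms: "negligible atoms"
  unfolding atoms_def by (intro countable_imp_null_set_lborel[THEN null_sets_completionI, folded negligible_iff_null_sets] \<nu>2.countable_support)

lemma integral_delay_has_derivative:
  assumes h: "continuous_on UNIV h" and t: "0 < t" "t \<notin> atoms"
  shows "((\<lambda>u. integral {0..u} (delay h)) has_real_derivative delay h t) (at t)"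
proof -
  have "((\<lambda>u. integral {0..u} (delay h)) has_vector_derivative delay h t) (at t within ({0..t+1} - {}))"
  proof (rule integral_has_vector_derivative_continuous_at)
    show "delay h integrable_on {0..t+1}" by (rule delay_integrable_on[OF h order_refl])
    have "isCont (delay h) t" using t by (intro delay_isCont[OF h]) (auto simp: atoms_def)
    then show "continuous (at t within {0..t+1} - {}) (delay h)"
      by (rule continuous_at_imp_continuous_at_within)
  qed (use t in auto)
  moreover have "at t within {0..t+1} = at t"
    using t by (intro at_within_interior) (simp add: interior_atLeastAtMost_real)
  ultimately show ?thesis by (simp add: has_real_derivative_iff_has_vector_derivative)
qed

end

section \<open>Picard iteration\<close>

locale delay_equation = delay_kernel +
  fixes f \<psi> :: "real \<Rightarrow> real"
  assumes f_cont: "continuous_on UNIV f" and f_pos: "\<And>x. 0 < f x"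
    and f_lip: "\<And>R. \<exists>L\<ge>0. \<forall>x\<in>{-R..R}. \<forall>y\<in>{-R..R}. \<bar>f x - f y\<bar> \<le> L * \<bar>x - y\<bar>"
    and psi_cont: "continuous_on UNIV \<psi>" and psi_pos: "\<And>t. 0 < \<psi> t"
begin

text \<open>Clamping with \<open>min\<close> and \<open>max\<close> puts the initial function and
  the integral equation into one formula, so continuity across \<open>t = 0\<close> follows by
  composition.\<close>

definition picard :: "(real \<Rightarrow> real) \<Rightarrow> real \<Rightarrow> real" where
  "picard x t = \<psi> (min t 0) + integral {0..max t 0} (delay (\<lambda>u. f (x u)))"

lemma continuous_f_comp: "continuous_on UNIV x \<Longrightarrow> continuous_on UNIV (\<lambda>u. f (x u))"
  using continuous_on_compose2[OF f_cont] by blast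

lemma picard_nonpos: "t \<le> 0 \<Longrightarrow> picard x t = \<psi> t"
  by (simp add: picard_def min_def max_def)

lemma delay_f_nonneg: "0 \<le> delay (\<lambda>u. f (x u)) t"
  by (rule delay_nonneg) (rule less_imp_le[OF f_pos])

lemma picard_diff:
  assumes x: "continuous_on UNIV x" and st: "0 \<le> s" "s \<le> t"
  shows "picard x t - picard x s = integral {s..t} (delay (\<lambda>u. f (x u)))"
proof -
  have "integral {0..s} (delay (\<lambda>u. f (x u))) + integral {s..t} (delay (\<lambda>u. f (x u)))
      = integral {0..t} (delay (\<lambda>u. f (x u)))"
    by (rule Henstock_Kurzweil_Integration.integral_combine[OF st delay_integrable_on[OF continuous_f_comp[OF x] order_refl]])
  moreover have "min s 0 = 0" "max s 0 = s" "min t 0 = 0" "max t 0 = t" using st by auto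
  ultimately show ?thesis by (simp add: picard_def)
qed

lemma continuous_picard:
  assumes x: "continuous_on UNIV x"
  shows "continuous_on UNIV (picard x)"
proof (rule continuous_on_UNIV_if_atMost)
  fix b :: real
  have c: "continuous_on {0..max b 0} (\<lambda>t. integral {0..t} (delay (\<lambda>u. f (x u))))"
    by (rule indefinite_integral_continuous_1[OF delay_integrable_on[OF continuous_f_comp[OF x] order_refl]])
  have "continuous_on {..b} (\<lambda>t. integral {0..max t 0} (delay (\<lambda>u. f (x u))))"
    by (rule continuous_on_compose2[OF c]) (auto intro!: continuous_intros)
  moreover have "continuous_on {..b} (\<lambda>t. \<psi> (min t 0))"
    by (rule continuous_on_compose2[OF psi_cont]) (auto intro!: continuous_intros)
  ultimately show "continuous_on {..b} (picard x)"
    unfolding picard_def[abs_def] by (intro continuous_on_add)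
qed

lemma picard_mono:
  assumes "continuous_on UNIV x" "0 \<le> s" "s \<le> t"
  shows "picard x s \<le> picard x t"
proof -
  have "0 \<le> integral {s..t} (delay (\<lambda>u. f (x u)))"
    by (intro integral_nonneg delay_integrable_on continuous_f_comp assms delay_f_nonneg)
  then show ?thesis using picard_diff[OF assms] by simp
qed

lemma picard_pos:
  assumes "continuous_on UNIV x"
  shows "0 < picard x t"
proof (cases "t \<le> 0")
  case True
  then show ?thesis by (simp add: picard_nonpos psi_pos)
next
  case False
  then show ?thesis using picard_mono[OF assms, of 0 t] psi_pos[of 0] by (simp add: picard_nonpos)
qed

text \<open>The weight \<open>exp (2 * mass * L * t)\<close> makes the Picard operator a contraction with factor \<open>1/2\<close>.\<close>

lemma picard_contraction:
  assumes x: "continuous_on UNIV x" and y: "continuous_on UNIV y" and L: "0 \<le> L" and D: "0 \<le> D"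
    and lip: "\<And>u. u \<in> {0..b} \<Longrightarrow> \<bar>f (x u) - f (y u)\<bar> \<le> L * \<bar>x u - y u\<bar>"
    and init: "\<And>u. u \<le> 0 \<Longrightarrow> x u = y u"
    and close: "\<And>u. u \<in> {0..b} \<Longrightarrow> \<bar>x u - y u\<bar> \<le> D * exp (2 * mass * L * u)"
    and t: "t \<in> {0..b}"
  shows "\<bar>picard x t - picard y t\<bar> \<le> D / 2 * exp (2 * mass * L * t)"
proof -
  let ?c = "2 * mass * L"
  let ?K = "\<lambda>s. delay (\<lambda>u. f (x u)) s - delay (\<lambda>u. f (y u)) s"
  have c: "0 \<le> ?c" using L mass_nonneg by simp
  note fx = continuous_f_comp[OF x] and fy = continuous_f_comp[OF y]
  \<comment> \<open>The bound \<open>mass * (L * (D * exp (?c * s)))\<close> is \<open>D / 2\<close>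
    times the derivative of \<open>exp (?c * s)\<close>: the 2 in the exponent becomes the
    contraction factor after integration.\<close>
  have K: "\<bar>?K s\<bar> \<le> D / 2 * (?c * exp (?c * s))" if s: "s \<in> {0..t}" for s
  proof -
    have "\<bar>delay (\<lambda>u. f (x u) - f (y u)) s\<bar> \<le> mass * (L * (D * exp (?c * s)))"
    proof (rule delay_bound)
      fix u assume u: "u \<in> {-\<tau>..s}"
      show "\<bar>f (x u) - f (y u)\<bar> \<le> L * (D * exp (?c * s))"
      proof (cases "u \<le> 0")
        case True
        then show ?thesis using init D L by simp
      next
        case False
        then have ub: "u \<in> {0..b}" using u s t by auto
        have "?c * u \<le> ?c * s" using u c by (intro mult_left_mono) auto
        then have "D * exp (?c * u) \<le> D * exp (?c * s)" using D by (intro mult_left_mono) auto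
        then have "L * \<bar>x u - y u\<bar> \<le> L * (D * exp (?c * s))"
          using close[OF ub] L by (intro mult_left_mono) auto
        then show ?thesis using lip[OF ub] by linarith
      qed
    qed (use s in \<open>auto intro!: continuous_on_diff fx fy\<close>)
    then show ?thesis using delay_diff[OF fx fy, of s] s by (simp add: mult_ac)
  qed
  have I: "?K integrable_on {0..t}"
    by (intro integrable_diff delay_integrable_on fx fy order_refl)
  have E: "((\<lambda>s. D / 2 * (?c * exp (?c * s))) has_integral D / 2 * (exp (?c * t) - 1)) {0..t}"
    using t by (intro has_integral_mult_right exp_has_integral) auto
  have "picard x t - picard y t = integral {0..t} ?K"
    using t picard_diff[OF x order_refl, of t] picard_diff[OF y order_refl, of t]
      delay_integrable_on[OF fx, of 0 t] delay_integrable_on[OF fy, of 0 t]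
    by (simp add: Henstock_Kurzweil_Integration.integral_diff picard_nonpos)
  also have "norm (integral {0..t} ?K) \<le> integral {0..t} (\<lambda>s. D / 2 * (?c * exp (?c * s)))"
    by (rule integral_norm_bound_integral[OF I has_integral_integrable[OF E]]) (use K in auto)
  also have "\<dots> = D / 2 * (exp (?c * t) - 1)" by (rule integral_unique[OF E])
  also have "\<dots> \<le> D / 2 * exp (?c * t)" using D by (intro mult_left_mono) auto
  finally show ?thesis by simp
qed

text \<open>On \<open>{0..t}\<close> both functions are bounded, so one Lipschitz constant serves
  for both. Each application of the contraction estimate reproduces the same two functions and
  halves the bound on their weighted distance, which is therefore 0.\<close>

lemma fixed_point_unique:
  assumes x: "continuous_on UNIV x" "picard x = x" and y: "continuous_on UNIV y" "picard y = y"
  shows "x = y"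
proof
  fix t
  show "x t = y t"
  proof (cases "t \<le> 0")
    case True
    then show ?thesis using picard_nonpos[of t x] picard_nonpos[of t y] x y by simp
  next
    case False
    obtain R where R: "0 \<le> R" "\<And>u. u \<in> {0..t} \<Longrightarrow> \<bar>x u\<bar> \<le> R" using continuous_bounded_Icc[OF x(1)] by blast
    obtain S where S: "0 \<le> S" "\<And>u. u \<in> {0..t} \<Longrightarrow> \<bar>y u\<bar> \<le> S" using continuous_bounded_Icc[OF y(1)] by blast
    obtain L where L: "0 \<le> L" "\<And>u v. u \<in> {-(R+S)..R+S} \<Longrightarrow> v \<in> {-(R+S)..R+S} \<Longrightarrow> \<bar>f u - f v\<bar> \<le> L * \<bar>u - v\<bar>"
      using f_lip[of "R+S"] by blast
    let ?c = "2 * mass * L"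
    have "\<bar>x u - y u\<bar> \<le> (R + S) / 2 ^ n * exp (?c * u)" if "u \<in> {0..t}" for n u
      using that
    proof (induction n arbitrary: u)
      case 0
      have "1 \<le> exp (?c * u)" using 0 L mass_nonneg by simp
      then have "(R + S) * 1 \<le> (R + S) * exp (?c * u)" using R S by (intro mult_left_mono) auto
      then show ?case using R(2)[OF 0] S(2)[OF 0] by simp
    next
      case (Suc n)
      have "\<bar>picard x u - picard y u\<bar> \<le> (R + S) / 2 ^ n / 2 * exp (?c * u)"
      proof (rule picard_contraction[OF x(1) y(1) L(1) _ _ _ Suc.IH Suc.prems])
        show "x u = y u" if "u \<le> 0" for u
          using that picard_nonpos[of u x] picard_nonpos[of u y] x y by simp
        show "\<bar>f (x u) - f (y u)\<bar> \<le> L * \<bar>x u - y u\<bar>" if "u \<in> {0..t}" for u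
          using R(1) S(1) R(2)[OF that] S(2)[OF that] by (intro L(2)) auto
      qed (use R S in auto)
      then show ?case using x y by (simp add: mult.commute)
    qed
    then have "\<bar>x t - y t\<bar> \<le> (R + S) / 2 ^ n * exp (?c * t)" for n using False by simp
    moreover have "(\<lambda>n. (R + S) / 2 ^ n * exp (?c * t)) \<longlonglongrightarrow> (R + S) * 0 * exp (?c * t)"
      unfolding divide_inverse power_inverse[symmetric]
      by (intro tendsto_intros LIMSEQ_realpow_zero) auto
    ultimately have "\<bar>x t - y t\<bar> \<le> (R + S) * 0 * exp (?c * t)"
      by (intro LIMSEQ_le_const) auto
    then show ?thesis by simp
  qed
qed

text \<open>The bound is the solution of the comparison problem
  \<open>y' = a * mass * (1 + y)\<close>, \<open>y 0 = P\<close>. It increases for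
  \<open>t \<ge> 0\<close>, so the whole past is dominated by its present value, and the integral of
  the resulting estimate reproduces it.\<close>

lemma picard_growth:
  assumes x: "continuous_on UNIV x" and a: "0 \<le> a" and growth: "\<And>u. 0 \<le> u \<Longrightarrow> f u \<le> a * (1 + u)"
    and P: "\<And>u. \<psi> u \<le> P"
    and bound: "\<And>u. 0 \<le> x u \<and> x u \<le> (1 + P) * exp (a * mass * max u 0) - 1"
  shows "picard x t \<le> (1 + P) * exp (a * mass * max t 0) - 1"
proof (cases "t \<le> 0")
  case True
  then show ?thesis using P[of t] by (simp add: picard_nonpos)
next
  case False
  let ?c = "a * mass"
  have c: "0 \<le> ?c" using a mass_nonneg by simp
  have P0: "0 \<le> P" using P[of 0] psi_pos[of 0] by linarith
  have K: "delay (\<lambda>u. f (x u)) s \<le> (1 + P) * (?c * exp (?c * s))" if s: "s \<in> {0..t}" for s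
  proof -
    have "\<bar>delay (\<lambda>u. f (x u)) s\<bar> \<le> mass * (a * ((1 + P) * exp (?c * s)))"
    proof (rule delay_bound[OF continuous_f_comp[OF x]])
      fix u assume u: "u \<in> {-\<tau>..s}"
      have "?c * max u 0 \<le> ?c * s" using u s c by (intro mult_left_mono) auto
      then have "(1 + P) * exp (?c * max u 0) \<le> (1 + P) * exp (?c * s)" using P0 by (intro mult_left_mono) auto
      then have "1 + x u \<le> (1 + P) * exp (?c * s)" using bound[of u] by linarith
      then have "a * (1 + x u) \<le> a * ((1 + P) * exp (?c * s))" using a by (rule mult_left_mono)
      then show "\<bar>f (x u)\<bar> \<le> a * ((1 + P) * exp (?c * s))"
        using growth[of "x u"] bound[of u] f_pos[of "x u"] by linarith
    qed (use s in auto)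
    then show ?thesis by (simp add: mult_ac)
  qed
  have E: "((\<lambda>s. (1 + P) * (?c * exp (?c * s))) has_integral (1 + P) * (exp (?c * t) - 1)) {0..t}"
    using False by (intro has_integral_mult_right exp_has_integral) auto
  have "picard x t = \<psi> 0 + integral {0..t} (delay (\<lambda>u. f (x u)))"
    using False by (simp add: picard_def)
  also have "\<dots> \<le> P + (1 + P) * (exp (?c * t) - 1)"
    using integral_le[OF delay_integrable_on[OF continuous_f_comp[OF x] order_refl] has_integral_integrable[OF E] K]
    unfolding integral_unique[OF E] by (rule add_mono[OF P])
  also have "\<dots> = (1 + P) * exp (?c * max t 0) - 1" using False by (simp add: algebra_simps)
  finally show ?thesis .
qed

text \<open>All iterates lie between 0 and \<open>B b\<close> on \<open>{..b}\<close>, so a single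
  Lipschitz constant controls every step there and the increments are dominated by a geometric
  series.\<close>

lemma fixed_point_exists:
  assumes a: "0 \<le> a" and growth: "\<And>u. 0 \<le> u \<Longrightarrow> f u \<le> a * (1 + u)" and P: "\<And>u. \<psi> u \<le> P"
  shows "\<exists>x. continuous_on UNIV x \<and> picard x = x"
proof -
  define X where "X n = (picard ^^ n) (\<lambda>t. \<psi> (min t 0))" for n
  have X0: "X 0 = (\<lambda>t. \<psi> (min t 0))" and XS: "X (Suc n) = picard (X n)" for n by (simp_all add: X_def)
  have Xc: "continuous_on UNIV (X n)" for n
  proof (induction n)
    case 0
    show ?case unfolding X0 by (rule continuous_on_compose2[OF psi_cont]) (auto intro!: continuous_intros)
  qed (simp add: XS continuous_picard)
  have Xn: "X n t = \<psi> t" if "t \<le> 0" for n t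
    using that by (cases n) (simp_all add: X0 XS picard_nonpos)
  define B where "B t = (1 + P) * exp (a * mass * max t 0) - 1" for t
  have P0: "0 \<le> P" using P[of 0] psi_pos[of 0] by linarith
  have Bmono: "B u \<le> B v" if "u \<le> v" for u v
    using that P0 a mass_nonneg unfolding B_def by (intro diff_right_mono mult_left_mono) (auto intro!: mult_left_mono)
  have XB: "0 \<le> X n t \<and> X n t \<le> B t" for n t
  proof (induction n arbitrary: t)
    case 0
    have "(1 + P) * 1 \<le> (1 + P) * exp (a * mass * max t 0)"
      using P0 a mass_nonneg by (intro mult_left_mono) auto
    then have "P \<le> B t" by (simp add: B_def)
    then show ?case using P[of "min t 0"] psi_pos[of "min t 0"] by (simp add: X0)
  next
    case (Suc n)
    then show ?case using picard_growth[OF Xc a growth P, of n t] picard_pos[OF Xc, of n t]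
      by (simp add: XS B_def)
  qed
  \<comment> \<open>The limit is written as a telescoping series, the form in which the Weierstrass
    test gives uniform convergence. It holds on the whole of \<open>{..b}\<close> because the
    iterates coincide for \<open>t \<le> 0\<close>.\<close>
  define x where "x t = X 0 t + (\<Sum>i. X (Suc i) t - X i t)" for t
  have lim: "uniform_limit {..b} X x sequentially" if b: "0 \<le> b" for b
  proof -
    obtain L where L: "0 \<le> L" "\<And>u v. u \<in> {-B b..B b} \<Longrightarrow> v \<in> {-B b..B b} \<Longrightarrow> \<bar>f u - f v\<bar> \<le> L * \<bar>u - v\<bar>"
      using f_lip[of "B b"] by blast
    let ?c = "2 * mass * L"
    have c: "0 \<le> ?c" using L mass_nonneg by simp
    have B0: "0 \<le> B b" using XB[of 0 b] by linarith
    have XBb: "0 \<le> X n u \<and> X n u \<le> B b" if "u \<le> b" for n u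
      using XB[of n u] Bmono[OF that] by linarith
    have step: "\<bar>X (Suc n) u - X n u\<bar> \<le> B b / 2 ^ n * exp (?c * u)" if "u \<in> {0..b}" for n u
      using that
    proof (induction n arbitrary: u)
      case 0
      have "1 \<le> exp (?c * u)" using 0 c by simp
      then have "B b * 1 \<le> B b * exp (?c * u)" using B0 by (intro mult_left_mono) auto
      then show ?case using XBb[of u 0] XBb[of u "Suc 0"] 0 by auto
    next
      case (Suc n)
      have "\<bar>picard (X (Suc n)) u - picard (X n) u\<bar> \<le> B b / 2 ^ n / 2 * exp (?c * u)"
      proof (rule picard_contraction[OF Xc Xc L(1) _ _ _ Suc.IH Suc.prems])
        show "\<bar>f (X (Suc n) u) - f (X n u)\<bar> \<le> L * \<bar>X (Suc n) u - X n u\<bar>" if "u \<in> {0..b}" for u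
          using XBb[of u "Suc n"] XBb[of u n] that B0 by (intro L(2)) auto
      qed (use Xn B0 in auto)
      then show ?case by (simp add: XS mult.commute)
    qed
    have "uniform_limit {..b} (\<lambda>n t. \<Sum>i<n. X (Suc i) t - X i t) (\<lambda>t. \<Sum>i. X (Suc i) t - X i t) sequentially"
    proof (rule Weierstrass_m_test)
      fix n u assume u: "u \<in> {..b}"
      have "0 \<le> B b * exp (?c * b) * (1/2) ^ n" using B0 by simp
      moreover have "\<bar>X (Suc n) u - X n u\<bar> \<le> B b * exp (?c * b) * (1/2) ^ n" if "0 \<le> u"
      proof -
        have "?c * u \<le> ?c * b" using u c by (intro mult_left_mono) auto
        then have "B b / 2 ^ n * exp (?c * u) \<le> B b / 2 ^ n * exp (?c * b)" using B0 by (intro mult_left_mono) auto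
        then show ?thesis using step[of u n] u that by (simp add: field_simps)
      qed
      ultimately show "norm (X (Suc n) u - X n u) \<le> B b * exp (?c * b) * (1/2) ^ n"
        using Xn[of u] by (cases "0 \<le> u") auto
    qed (intro summable_mult summable_geometric, simp)
    from uniform_limit_add[OF uniform_limit_const[where c="X 0"] this]
    have "uniform_limit {..b} (\<lambda>n t. X 0 t + (\<Sum>i<n. X (Suc i) t - X i t)) x sequentially"
      by (simp add: x_def[abs_def])
    moreover have "X 0 t + (\<Sum>i<n. X (Suc i) t - X i t) = X n t" for n t
      using sum_lessThan_telescope[of "\<lambda>i. X i t" n] by simp
    ultimately show ?thesis by simp
  qed
  have xc: "continuous_on UNIV x"
  proof (rule continuous_on_UNIV_if_atMost)
    fix b
    have "continuous_on {..max b 0} x"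
      by (rule uniform_limit_theorem[OF _ lim]) (auto intro: always_eventually continuous_on_subset[OF Xc])
    then show "continuous_on {..b} x" by (rule continuous_on_subset) auto
  qed
  have Xlim: "(\<lambda>n. X n t) \<longlonglongrightarrow> x t" for t
    using tendsto_uniform_limitI[OF lim[of "max t 0"], of t] by simp
  have xn: "x t = \<psi> t" if "t \<le> 0" for t
    using LIMSEQ_unique[OF Xlim[of t]] Xn[OF that] by simp
  have xB: "0 \<le> x t \<and> x t \<le> B t" for t
    using LIMSEQ_le_const[OF Xlim, of 0 t] LIMSEQ_le_const2[OF Xlim, of t "B t"] XB by auto
  have "picard x t = x t" for t
  proof (cases "t \<le> 0")
    case True
    then show ?thesis by (simp add: picard_nonpos xn)
  next
    case False
    obtain L where L: "0 \<le> L" "\<And>u v. u \<in> {-B t..B t} \<Longrightarrow> v \<in> {-B t..B t} \<Longrightarrow> \<bar>f u - f v\<bar> \<le> L * \<bar>u - v\<bar>"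
      using f_lip[of "B t"] by blast
    let ?c = "2 * mass * L"
    have c: "0 \<le> ?c" using L mass_nonneg by simp
    have "(\<lambda>n. picard (X n) t) \<longlonglongrightarrow> picard x t"
    proof (rule tendstoI)
      fix e :: real assume e: "0 < e"
      \<comment> \<open>The contraction estimate now serves as continuity of \<open>picard\<close>
        under uniform convergence; dividing by the weight at \<open>t\<close> turns its bound into
        \<open>e / 2\<close>.\<close>
      define d where "d = e / exp (?c * t)"
      have d: "0 < d" using e by (simp add: d_def)
      have "\<forall>\<^sub>F n in sequentially. \<forall>u\<in>{..t}. dist (X n u) (x u) < d"
        using lim[of t] False d by (auto simp: uniform_limit_iff)
      then show "\<forall>\<^sub>F n in sequentially. dist (picard (X n) t) (picard x t) < e"
      proof eventually_elim
        case (elim n)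
        have "\<bar>picard (X n) t - picard x t\<bar> \<le> d / 2 * exp (?c * t)"
        proof (rule picard_contraction[OF Xc xc L(1), where b=t])
          fix u assume u: "u \<in> {0..t}"
          have "1 \<le> exp (?c * u)" using u c by simp
          then have "d * 1 \<le> d * exp (?c * u)" using d by (intro mult_left_mono) auto
          moreover have "dist (X n u) (x u) < d" using elim u by auto
          ultimately show "\<bar>X n u - x u\<bar> \<le> d * exp (?c * u)" by (simp add: dist_real_def)
          have "B u \<le> B t" using u by (intro Bmono) auto
          then show "\<bar>f (X n u) - f (x u)\<bar> \<le> L * \<bar>X n u - x u\<bar>"
            using XB[of n u] xB[of u] by (intro L(2)) auto
        qed (use Xn xn d False in auto)
        also have "\<dots> < e" using e by (simp add: d_def)
        finally show ?case by (simp add: dist_real_def)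
      qed
    qed
    moreover have "(\<lambda>n. picard (X n) t) \<longlonglongrightarrow> x t"
      using LIMSEQ_Suc[OF Xlim[of t]] by (simp add: XS)
    ultimately show ?thesis by (rule LIMSEQ_unique)
  qed
  with xc show ?thesis by blast
qed

section \<open>Regularity of fixed points\<close>

lemma fixed_point_has_derivative:
  assumes x: "continuous_on UNIV x" "picard x = x" and t: "0 < t" "t \<notin> atoms"
  shows "(x has_real_derivative delay (\<lambda>u. f (x u)) t) (at t)"
proof -
  have "((\<lambda>u. \<psi> 0 + integral {0..u} (delay (\<lambda>u. f (x u)))) has_real_derivative delay (\<lambda>u. f (x u)) t) (at t)"
    using integral_delay_has_derivative[OF continuous_f_comp[OF x(1)] t]
    by (auto intro!: derivative_eq_intros)
  then show ?thesis
  proof (rule has_field_derivative_transform_within_open[where S="{0<..}"])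
    fix u :: real assume u: "u \<in> {0<..}"
    have "x u = picard x u" using x(2) by simp
    also have "\<dots> = \<psi> 0 + integral {0..u} (delay (\<lambda>u. f (x u)))" using u by (simp add: picard_def)
    finally show "\<psi> 0 + integral {0..u} (delay (\<lambda>u. f (x u))) = x u" by simp
  qed (use t in auto)
qed

text \<open>The integrand \<open>delay (\<lambda>u. f (x u))\<close> is bounded on
  \<open>{0..b}\<close> even where it jumps. The Lipschitz bound yields absolute continuity of
  \<open>x\<close>, and later that of \<open>F\<close> composed with \<open>x\<close>.\<close>

lemma fixed_point_lipschitz:
  assumes x: "continuous_on UNIV x" "picard x = x"
  shows "\<exists>C. C-lipschitz_on {0..b} x"
proof -
  obtain B where B: "0 \<le> B" "\<And>u. u \<in> {-\<tau>..b} \<Longrightarrow> \<bar>f (x u)\<bar> \<le> B"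
    using continuous_bounded_Icc[OF continuous_f_comp[OF x(1)]] by blast
  have *: "\<bar>x t - x s\<bar> \<le> mass * B * (t - s)" if st: "0 \<le> s" "s \<le> t" "t \<le> b" for s t
  proof -
    have "norm (integral {s..t} (delay (\<lambda>u. f (x u)))) \<le> mass * B * (t - s)"
      using has_integral_bound_real[OF _ finite.emptyI integrable_integral[OF delay_integrable_on[OF continuous_f_comp[OF x(1)] st(1), of t]], of "mass * B"]
        delay_bound[OF continuous_f_comp[OF x(1)], of _ B] B mass_nonneg st by auto
    then show ?thesis using picard_diff[OF x(1) st(1,2)] x(2) by simp
  qed
  have "(mass * B)-lipschitz_on {0..b} x"
  proof (rule lipschitz_onI)
    fix s t assume "s \<in> {0..b}" "t \<in> {0..b}"
    then show "dist (x s) (x t) \<le> mass * B * dist s t"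
      using *[of s t] *[of t s] by (cases "s \<le> t") (auto simp: dist_real_def)
  qed (use B mass_nonneg in simp)
  then show ?thesis ..
qed

end

section \<open>Growth of the solution\<close>

locale sublinear_function =
  fixes \<phi> \<phi>' :: "real \<Rightarrow> real"
  assumes phi_cont: "continuous_on {0..} \<phi>" and phi_pos: "\<And>u. 0 \<le> u \<Longrightarrow> 0 < \<phi> u"
    and phi_deriv: "\<And>u. 0 < u \<Longrightarrow> (\<phi> has_real_derivative \<phi>' u) (at u)"
    and phi'_pos: "\<And>u. 0 < u \<Longrightarrow> 0 < \<phi>' u"
    and phi'_lim: "(\<phi>' \<longlongrightarrow> 0) at_top"
begin

text \<open>The left endpoint may be 0, where \<phi> is only assumed continuous; the intermediate
  point is interior, hence positive.\<close>

lemma phi_mvt: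
  assumes "0 \<le> a" "a < b"
  shows "\<exists>z>a. z < b \<and> \<phi> b - \<phi> a = (b - a) * \<phi>' z"
proof -
  have "\<exists>l z. a < z \<and> z < b \<and> (\<phi> has_real_derivative l) (at z) \<and> \<phi> b - \<phi> a = (b - a) * l"
  proof (rule MVT)
    show "continuous_on {a..b} \<phi>" using assms by (intro continuous_on_subset[OF phi_cont]) auto
    show "\<phi> differentiable at u" if "a < u" for u
      using phi_deriv[of u] that assms by (auto simp: real_differentiable_def)
  qed (use assms in auto)
  then obtain l z where z: "a < z" "z < b" "(\<phi> has_real_derivative l) (at z)" "\<phi> b - \<phi> a = (b - a) * l" by blast
  then have "l = \<phi>' z" using phi_deriv[of z] assms by (auto intro: DERIV_unique)
  with z show ?thesis by blast
qed

lemma phi_mono: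
  assumes "0 \<le> a" "a \<le> b"
  shows "\<phi> a \<le> \<phi> b"
proof (cases "a = b")
  case False
  with assms obtain z where "a < z" "\<phi> b - \<phi> a = (b - a) * \<phi>' z" using phi_mvt[of a b] by auto
  moreover have "0 \<le> (b - a) * \<phi>' z"
    using phi'_pos[of z] assms \<open>a < z\<close> by (intro mult_nonneg_nonneg) auto
  ultimately show ?thesis by linarith
qed simp

text \<open>Beyond some \<open>X\<close> the slope is below 1, and up to \<open>X\<close>
  monotonicity bounds \<phi> by \<open>\<phi> X\<close>. This linear bound is what excludes blow-up
  in finite time.\<close>

lemma phi_linear_growth: "\<exists>a\<ge>0. \<forall>u\<ge>0. \<phi> u \<le> a * (1 + u)"
proof -
  have "\<forall>\<^sub>F u in at_top. \<phi>' u < 1" by (rule order_tendstoD(2)[OF phi'_lim]) simp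
  then obtain X0 where X0: "\<And>u. u \<ge> X0 \<Longrightarrow> \<phi>' u < 1" by (auto simp: eventually_at_top_linorder)
  define X where "X = max X0 0"
  have X: "0 \<le> X" "\<And>u. u \<ge> X \<Longrightarrow> \<phi>' u < 1" using X0 by (auto simp: X_def)
  have "\<phi> u \<le> \<phi> X + u" if u: "0 \<le> u" for u
  proof (cases "u \<le> X")
    case True
    then show ?thesis using phi_mono[OF u True] u by linarith
  next
    case False
    then obtain z where z: "X < z" "\<phi> u - \<phi> X = (u - X) * \<phi>' z" using phi_mvt[OF X(1), of u] by auto
    have "(u - X) * \<phi>' z \<le> (u - X) * 1" using X(2)[of z] z False by (intro mult_left_mono) auto
    then have "\<phi> u - \<phi> X \<le> u - X" using z(2) by simp
    then show ?thesis using X(1) by linarith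
  qed
  moreover have "\<phi> X + u \<le> (\<phi> X + 1) * (1 + u)" if "0 \<le> u" for u
    using phi_pos[OF X(1)] that by (simp add: algebra_simps)
  ultimately show ?thesis using phi_pos[OF X(1)] by (intro exI[of _ "\<phi> X + 1"]) (auto intro: order_trans)
qed

end

text \<open>Applied to \<open>f / \<phi>\<close> and to \<open>\<phi> / f\<close>, this turns the
  asymptotic relation at infinity into inequalities on the whole half-line.\<close>

lemma bounded_above_of_tendsto:
  fixes g :: "real \<Rightarrow> real"
  assumes g: "continuous_on {0..} g" and lim: "(g \<longlongrightarrow> l) at_top"
  shows "\<exists>C>0. \<forall>u\<ge>0. g u \<le> C"
proof -
  have "\<forall>\<^sub>F u in at_top. g u < l + 1" by (rule order_tendstoD(2)[OF lim]) simp
  then obtain X where X: "\<And>u. u \<ge> X \<Longrightarrow> g u < l + 1" by (auto simp: eventually_at_top_linorder)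
  have "compact (g ` {0..X})"
    by (intro compact_continuous_image continuous_on_subset[OF g]) auto
  then have "bounded (g ` {0..X})" by (rule compact_imp_bounded)
  then obtain B where B: "\<forall>y\<in>g ` {0..X}. norm y \<le> B" unfolding bounded_iff by blast
  have "g u \<le> max 1 (max B (l + 1))" if "0 \<le> u" for u
  proof (cases "u \<le> X")
    case True
    then have "norm (g u) \<le> B" using B that by auto
    then show ?thesis by auto
  next
    case False
    then show ?thesis using X[of u] by (simp add: le_max_iff_disj)
  qed
  then show ?thesis by (intro exI[of _ "max 1 (max B (l + 1))"]) auto
qed

text \<open>This is the continuous form of Cesaro averaging. Only increments of \<open>G\<close>
  beyond \<open>T0\<close> are prescribed, since the derivative formula for \<open>F (x t)\<close>
  is available only for large times; the value at the starting point disappears on division by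
  \<open>t\<close>.\<close>

lemma tendsto_average:
  fixes g G :: "real \<Rightarrow> real"
  assumes int: "\<And>s t. T0 \<le> s \<Longrightarrow> s \<le> t \<Longrightarrow> (g has_integral (G t - G s)) {s..t}"
    and lim: "(g \<longlongrightarrow> m) at_top"
  shows "((\<lambda>t. G t / t) \<longlongrightarrow> m) at_top"
proof (rule tendstoI)
  fix e :: real assume e: "0 < e"
  have "\<forall>\<^sub>F r in at_top. dist (g r) m < e / 2" using lim e by (intro tendstoD) auto
  then obtain T1 where T1: "\<And>r. r \<ge> T1 \<Longrightarrow> dist (g r) m < e / 2" by (auto simp: eventually_at_top_linorder)
  define T where "T = max 1 (max T0 T1)"
  have T: "1 \<le> T" "T0 \<le> T" "T1 \<le> T" by (auto simp: T_def)
  have est: "\<bar>(G t - G T) - m * (t - T)\<bar> \<le> e / 2 * (t - T)" if t: "T \<le> t" for t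
  proof -
    have "((\<lambda>r. g r - m) has_integral (G t - G T) - m * (t - T)) {T..t}"
      using int[OF T(2) t] has_integral_const_real[of m T t] t by (intro has_integral_diff) (auto simp: mult.commute)
    from has_integral_bound_real[OF _ finite.emptyI this, of "e / 2"]
    show ?thesis using T1 T t e by (auto simp: dist_real_def less_imp_le)
  qed
  have "((\<lambda>t. \<bar>G T - m * T\<bar> / t) \<longlongrightarrow> 0) at_top"
    by (intro tendsto_divide_0[OF tendsto_const] filterlim_at_top_imp_at_infinity filterlim_ident)
  then have "\<forall>\<^sub>F t in at_top. \<bar>G T - m * T\<bar> / t < e / 2" using e by (intro order_tendstoD(2)) auto
  moreover have "\<forall>\<^sub>F t in at_top. T \<le> t" by (rule eventually_ge_at_top)
  ultimately show "\<forall>\<^sub>F t in at_top. dist (G t / t) m < e"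
  proof eventually_elim
    case (elim t)
    have t: "0 < t" using elim T by linarith
    have "\<bar>G T - m * T\<bar> < e / 2 * t" using elim(1) t by (simp add: divide_less_eq)
    moreover have "e / 2 * (t - T) \<le> e / 2 * t" using e T by (intro mult_left_mono) auto
    ultimately have "\<bar>G t - m * t\<bar> < e * t"
      using est[OF elim(2)] by (simp add: algebra_simps) (smt (verit))
    moreover have "G t / t - m = (G t - m * t) / t" using t by (simp add: field_simps)
    ultimately show ?case using t by (simp add: dist_real_def abs_divide divide_less_eq)
  qed
qed

context delay_kernel
begin

text \<open>For fixed \<open>s\<close> the cut-off is eventually inactive, so both integrands tend
  to 1 and dominated convergence gives the two total masses. With \<open>h = g = 1\<close> it yields
  a lower bound for the speed of \<open>x\<close>; with \<open>f\<close> and \<phi> along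
  \<open>x\<close> it yields the asymptotics.\<close>

lemma delay_ratio_tendsto_mass:
  assumes h: "continuous_on UNIV h"
    and bound: "\<And>t u. 0 \<le> t \<Longrightarrow> u \<in> {-\<tau>..t} \<Longrightarrow> \<bar>h u\<bar> \<le> C * g t" and g: "\<And>t. 0 \<le> t \<Longrightarrow> 0 < g t"
    and lim: "\<And>s. 0 \<le> s \<Longrightarrow> ((\<lambda>t. h (t - s) / g t) \<longlongrightarrow> 1) at_top"
  shows "((\<lambda>t. delay h t / g t) \<longlongrightarrow> mass) at_top"
proof -
  have [measurable]: "h \<in> borel_measurable borel" by (rule borel_measurable_continuous_onI[OF h])
  have 1: "((\<lambda>t. LINT s|\<nu>\<^sub>1. h (t - s) / g t) \<longlongrightarrow> (LINT s|\<nu>\<^sub>1. 1)) at_top"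
  proof (rule integral_dominated_convergence_at_top[where w="\<lambda>_. C"])
    show "AE s in \<nu>\<^sub>1. ((\<lambda>t. h (t - s) / g t) \<longlongrightarrow> 1) at_top"
      using supp1 by eventually_elim (rule lim, simp)
    show "\<forall>\<^sub>F t in at_top. AE s in \<nu>\<^sub>1. norm (h (t - s) / g t) \<le> C"
      using eventually_ge_at_top[of 0]
    proof eventually_elim
      case (elim t)
      have "AE s in \<nu>\<^sub>1. norm (h (t - s)) \<le> C * g t"
        by (rule AE_delay_integrand_bounded(1)[OF elim]) (use bound elim in auto)
      then show ?case
        by eventually_elim (use g[OF elim] in \<open>simp add: abs_divide divide_le_eq\<close>)
    qed
  qed auto
  have 2: "((\<lambda>t. LINT s|\<nu>\<^sub>2. indicator {..t} s * h (t - s) / g t) \<longlongrightarrow> (LINT s|\<nu>\<^sub>2. 1)) at_top"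
  proof (rule integral_dominated_convergence_at_top[where w="\<lambda>_. C"])
    show "AE s in \<nu>\<^sub>2. ((\<lambda>t. indicator {..t} s * h (t - s) / g t) \<longlongrightarrow> 1) at_top"
      using supp2
    proof eventually_elim
      case (elim s)
      have "\<forall>\<^sub>F t in at_top. h (t - s) / g t = indicator {..t} s * h (t - s) / g t"
        using eventually_ge_at_top[of s] by eventually_elim simp
      then show ?case using lim[OF elim] by (rule Lim_transform_eventually[rotated])
    qed
    show "\<forall>\<^sub>F t in at_top. AE s in \<nu>\<^sub>2. norm (indicator {..t} s * h (t - s) / g t) \<le> C"
      using eventually_ge_at_top[of 0]
    proof eventually_elim
      case (elim t)
      have "AE s in \<nu>\<^sub>2. norm (indicator {..t} s * h (t - s)) \<le> C * g t"
        by (rule AE_delay_integrand_bounded(2)[OF elim]) (use bound elim in auto)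
      then show ?case
        by eventually_elim (use g[OF elim] in \<open>simp add: abs_divide divide_le_eq\<close>)
    qed
  qed auto
  show ?thesis
    using tendsto_add[OF 1 2] by (simp add: delay_def mass_def add_divide_distrib)
qed

lemma delay_mono:
  assumes "continuous_on UNIV h" "continuous_on UNIV g" "0 \<le> t" "\<And>u. h u \<le> g u"
  shows "delay h t \<le> delay g t"
  using delay_nonneg[of "\<lambda>u. g u - h u" t] delay_diff[OF assms(2,1,3)] assms(4) by simp

lemma delay_const: "delay (\<lambda>_. c) t = c * delay (\<lambda>_. 1) t"
  by (simp add: delay_def algebra_simps)

end

section \<open>Asymptotics of a fixed point\<close>

locale delay_asymptotics = delay_equation + sublinear_function +
  fixes x :: "real \<Rightarrow> real"
  assumes f_asymp: "((\<lambda>u. f u / \<phi> u) \<longlongrightarrow> 1) at_top" and mass_pos: "0 < mass"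
    and x_cont: "continuous_on UNIV x" and x_fixed: "picard x = x"
begin

lemma x_pos: "0 < x t"
  using picard_pos[OF x_cont, of t] x_fixed by simp

lemma x_mono: "0 \<le> s \<Longrightarrow> s \<le> t \<Longrightarrow> x s \<le> x t"
  using picard_mono[OF x_cont, of s t] x_fixed by simp

lemma f_cont0: "continuous_on {0..} f"
  by (rule continuous_on_subset[OF f_cont]) simp

lemma f_le_phi: "\<exists>C>0. \<forall>u\<ge>0. f u \<le> C * \<phi> u"
proof -
  have "continuous_on {0..} (\<lambda>u. f u / \<phi> u)"
    using phi_pos by (intro continuous_on_divide f_cont0 phi_cont) (auto simp: less_le)
  from bounded_above_of_tendsto[OF this f_asymp] show ?thesis
    using phi_pos by (auto simp: divide_le_eq)
qed

lemma phi_over_f: "((\<lambda>u. \<phi> u / f u) \<longlongrightarrow> 1) at_top"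
  using tendsto_inverse[OF f_asymp] by simp

text \<open>From \<open>\<phi> \<le> C * f\<close> and the monotonicity of \<phi>, the positive
  value \<open>\<phi> 0\<close> bounds \<open>C * f\<close> from below.\<close>

lemma f_bounded_below: "\<exists>c>0. \<forall>u\<ge>0. c \<le> f u"
proof -
  have "continuous_on {0..} (\<lambda>u. \<phi> u / f u)"
    using f_pos by (intro continuous_on_divide f_cont0 phi_cont) (auto simp: less_le)
  from bounded_above_of_tendsto[OF this phi_over_f]
  obtain C where C: "0 < C" "\<And>u. 0 \<le> u \<Longrightarrow> \<phi> u / f u \<le> C" by blast
  have "\<phi> 0 / C \<le> f u" if u: "0 \<le> u" for u
  proof -
    have "\<phi> 0 \<le> C * f u" using phi_mono[OF order_refl u] C(2)[OF u] f_pos[of u] by (simp add: divide_le_eq)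
    then show ?thesis using C by (simp add: divide_le_eq mult.commute)
  qed
  then show ?thesis using C phi_pos[of 0] by (intro exI[of _ "\<phi> 0 / C"]) auto
qed

text \<open>\<open>delay (\<lambda>_. 1) t\<close> is the mass of the delays active at time
  \<open>t\<close>. It may vanish for small \<open>t\<close> if the mass sits at large delays, but
  it exceeds \<open>mass / 2\<close> eventually, and from then on \<open>x\<close> grows at least
  linearly.\<close>

lemma x_at_top: "filterlim x at_top at_top"
proof -
  obtain c where c: "0 < c" "\<And>u. 0 \<le> u \<Longrightarrow> c \<le> f u" using f_bounded_below by blast
  have "((\<lambda>t. delay (\<lambda>_. 1) t / 1) \<longlongrightarrow> mass) at_top"
    by (rule delay_ratio_tendsto_mass[where C=1]) auto
  then have "\<forall>\<^sub>F t in at_top. mass / 2 < delay (\<lambda>_. 1) t"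
    using mass_pos by (intro order_tendstoD(1)) auto
  then obtain T0 where T0: "\<And>t. t \<ge> T0 \<Longrightarrow> mass / 2 < delay (\<lambda>_. 1) t" by (auto simp: eventually_at_top_linorder)
  define T where "T = max 0 T0"
  have T: "0 \<le> T" "\<And>t. t \<ge> T \<Longrightarrow> mass / 2 < delay (\<lambda>_. 1) t" using T0 by (auto simp: T_def)
  note fx = continuous_f_comp[OF x_cont]
  have low: "c * (mass / 2) \<le> delay (\<lambda>u. f (x u)) t" if t: "T \<le> t" for t
  proof -
    have "c * (mass / 2) \<le> delay (\<lambda>_. c) t"
      unfolding delay_const[of c] using T(2)[OF t] c by (intro mult_left_mono) auto
    also have "\<dots> \<le> delay (\<lambda>u. f (x u)) t"
      using c(2) x_pos T t by (intro delay_mono fx) (auto intro: less_imp_le)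
    finally show ?thesis .
  qed
  have "x T + c * (mass / 2) * (t - T) \<le> x t" if t: "T \<le> t" for t
  proof -
    have "integral {T..t} (\<lambda>_. c * (mass / 2)) \<le> integral {T..t} (delay (\<lambda>u. f (x u)))"
      by (intro integral_le delay_integrable_on fx T) (use low in auto)
    then show ?thesis using picard_diff[OF x_cont T(1) t] x_fixed t by (simp add: field_simps)
  qed
  then have "\<forall>\<^sub>F t in at_top. x T + c * (mass / 2) * (t - T) \<le> x t"
    by (rule eventually_mono[OF eventually_ge_at_top])
  moreover have "filterlim (\<lambda>t. x T + c * (mass / 2) * (t - T)) at_top at_top"
  proof (rule filterlim_tendsto_add_at_top[OF tendsto_const], rule filterlim_tendsto_pos_mult_at_top[OF tendsto_const])
    show "filterlim (\<lambda>t. t - T) at_top at_top"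
      using filterlim_tendsto_add_at_top[OF tendsto_const[of "- T"] filterlim_ident] by simp
  qed (use c mass_pos in auto)
  ultimately show ?thesis by (rule filterlim_at_top_mono[rotated])
qed

text \<open>At nonnegative times monotonicity of \<open>x\<close> and \<phi> suffices. The initial
  segment need not be monotone and may exceed \<open>x t\<close>; there the bound \<open>B\<close>
  is absorbed through \<open>\<phi> 0 \<le> \<phi> (x t)\<close>, whence the summand
  \<open>B / \<phi> 0\<close>.\<close>

lemma f_x_le_phi_x: "\<exists>C>0. \<forall>t\<ge>0. \<forall>u\<in>{-\<tau>..t}. \<bar>f (x u)\<bar> \<le> C * \<phi> (x t)"
proof -
  obtain C where C: "0 < C" "\<And>u. 0 \<le> u \<Longrightarrow> f u \<le> C * \<phi> u" using f_le_phi by blast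
  obtain B where B: "0 \<le> B" "\<And>u. u \<in> {-\<tau>..0} \<Longrightarrow> \<bar>f (x u)\<bar> \<le> B"
    using continuous_bounded_Icc[OF continuous_f_comp[OF x_cont]] by blast
  have "\<bar>f (x u)\<bar> \<le> (C + B / \<phi> 0) * \<phi> (x t)" if t: "0 \<le> t" and u: "u \<in> {-\<tau>..t}" for t u
  proof (cases "u \<le> 0")
    case True
    have "B / \<phi> 0 * \<phi> 0 \<le> B / \<phi> 0 * \<phi> (x t)"
      using B phi_pos[of 0] phi_mono[of 0 "x t"] x_pos[of t] by (intro mult_left_mono) auto
    moreover have "0 \<le> C * \<phi> (x t)" using C phi_pos[of "x t"] x_pos[of t] by simp
    ultimately show ?thesis using B(2)[of u] True u phi_pos[of 0] by (simp add: distrib_right)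
  next
    case False
    have "f (x u) \<le> C * \<phi> (x u)" using C x_pos[of u] by simp
    also have "\<dots> \<le> C * \<phi> (x t)"
      using C u False x_pos[of u] by (intro mult_left_mono phi_mono x_mono) auto
    also have "\<dots> \<le> (C + B / \<phi> 0) * \<phi> (x t)"
      using B phi_pos[of 0] phi_pos[of "x t"] x_pos[of t] by (intro mult_right_mono) auto
    finally show ?thesis using f_pos[of "x u"] by simp
  qed
  moreover have "0 < C + B / \<phi> 0" using B C phi_pos[of 0] by (simp add: add_pos_nonneg)
  ultimately show ?thesis by blast
qed

text \<open>Over a time interval of fixed length \<open>x\<close> grows by at most a multiple of \<open>\<phi> (x t)\<close>;
  since \<open>\<phi>'\<close> vanishes at infinity, \<open>\<phi> \<circ> x\<close> varies slowly.\<close>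

lemma phi_x_shift:
  assumes s: "0 \<le> s"
  shows "((\<lambda>t. \<phi> (x (t - s)) / \<phi> (x t)) \<longlongrightarrow> 1) at_top"
proof -
  obtain C where C: "0 < C" "\<And>t u. 0 \<le> t \<Longrightarrow> u \<in> {-\<tau>..t} \<Longrightarrow> \<bar>f (x u)\<bar> \<le> C * \<phi> (x t)"
    using f_x_le_phi_x by blast
  note fx = continuous_f_comp[OF x_cont]
  have phx: "0 < \<phi> (x t)" for t using phi_pos x_pos[of t] by simp
  have inc: "x t - x (t - s) \<le> s * (mass * C) * \<phi> (x t)" if t: "s \<le> t" for t
  proof -
    have K: "norm (delay (\<lambda>u. f (x u)) r) \<le> mass * (C * \<phi> (x t))" if r: "r \<in> {t-s..t}" for r
    proof -
      have r0: "0 \<le> r" "r \<le> t" using r t by auto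
      have "\<bar>delay (\<lambda>u. f (x u)) r\<bar> \<le> mass * (C * \<phi> (x r))" by (rule delay_bound[OF fx r0(1) C(2)[OF r0(1)]])
      also have "\<dots> \<le> mass * (C * \<phi> (x t))"
        using mass_pos C(1) x_pos[of r] r0 by (intro mult_left_mono phi_mono x_mono) auto
      finally show ?thesis by simp
    qed
    have "norm (integral {t-s..t} (delay (\<lambda>u. f (x u)))) \<le> mass * (C * \<phi> (x t)) * measure lborel {t-s..t}"
      using mass_pos C(1) phx[of t] K t s
      by (intro has_integral_bound_real[OF _ finite.emptyI integrable_integral] delay_integrable_on fx) auto
    then show ?thesis using picard_diff[OF x_cont, of "t-s" t] x_fixed t s by (simp add: mult_ac)
  qed
  show ?thesis
  proof (rule tendstoI)
    fix e :: real assume e: "0 < e"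
    \<comment> \<open>The slope bound \<open>d\<close> offsets the factor
      \<open>s * (mass * C)\<close> of the increment estimate \<open>inc\<close>; the
      \<open>+ 1\<close> covers \<open>s = 0\<close> and makes the final inequality strict.\<close>
    define d where "d = e / (s * (mass * C) + 1)"
    have sc: "0 \<le> s * (mass * C)" using s mass_pos C by simp
    then have d: "0 < d" using e by (simp add: d_def)
    have "\<forall>\<^sub>F z in at_top. \<phi>' z < d" by (rule order_tendstoD(2)[OF phi'_lim d])
    then obtain Z where Z: "\<And>z. z \<ge> Z \<Longrightarrow> \<phi>' z < d" by (auto simp: eventually_at_top_linorder)
    have "filterlim (\<lambda>t. t - s) at_top at_top"
      using filterlim_tendsto_add_at_top[OF tendsto_const[of "- s"] filterlim_ident] by simp
    from filterlim_compose[OF x_at_top this]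
    have "\<forall>\<^sub>F t in at_top. Z \<le> x (t - s)" by (simp add: filterlim_at_top)
    with eventually_ge_at_top[of s] show "\<forall>\<^sub>F t in at_top. dist (\<phi> (x (t - s)) / \<phi> (x t)) 1 < e"
    proof eventually_elim
      case (elim t)
      have le: "x (t - s) \<le> x t" using elim s by (intro x_mono) auto
      have "\<bar>\<phi> (x (t - s)) - \<phi> (x t)\<bar> < e * \<phi> (x t)"
      proof (cases "x (t - s) = x t")
        case True
        then show ?thesis using e phx by simp
      next
        case False
        then have "x (t - s) < x t" using le by simp
        then obtain z where z: "x (t - s) < z" "\<phi> (x t) - \<phi> (x (t - s)) = (x t - x (t - s)) * \<phi>' z"
          using phi_mvt[of "x (t - s)" "x t"] x_pos[of "t - s"] by auto
        have "(x t - x (t - s)) * \<phi>' z \<le> s * (mass * C) * \<phi> (x t) * d"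
          using inc[OF elim(1)] Z[of z] z elim(2) le phi'_pos[of z] x_pos[of "t - s"] sc phx[of t]
          by (intro mult_mono) auto
        also have "\<dots> < (s * (mass * C) + 1) * d * \<phi> (x t)"
          using d phx[of t] by (simp add: algebra_simps)
        also have "(s * (mass * C) + 1) * d = e" using sc by (simp add: d_def)
        finally have "\<phi> (x t) - \<phi> (x (t - s)) < e * \<phi> (x t)" using z by simp
        moreover have "\<phi> (x (t - s)) \<le> \<phi> (x t)" using le x_pos[of "t - s"] by (intro phi_mono) auto
        ultimately show ?thesis by simp
      qed
      moreover have "\<phi> (x (t - s)) / \<phi> (x t) - 1 = (\<phi> (x (t - s)) - \<phi> (x t)) / \<phi> (x t)"
        using phx[of t] by (simp add: field_simps)
      ultimately show ?case using phx[of t] by (simp add: dist_real_def abs_divide divide_less_eq)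
    qed
  qed
qed

text \<open>The limit is taken relative to \<open>\<phi> (x t)\<close>, where a majorant is at hand:
  \<open>f (x (t - s)) / \<phi> (x t)\<close> factors through \<open>\<phi> (x (t - s))\<close>. The
  factor \<open>\<phi> (x t) / f (x t)\<close> then replaces \<phi> by \<open>f\<close>.\<close>

lemma delay_over_f_x: "((\<lambda>t. delay (\<lambda>u. f (x u)) t / f (x t)) \<longlongrightarrow> mass) at_top"
proof -
  have phx: "0 < \<phi> (x t)" for t using phi_pos x_pos[of t] by simp
  obtain C where C: "0 < C" "\<And>t u. 0 \<le> t \<Longrightarrow> u \<in> {-\<tau>..t} \<Longrightarrow> \<bar>f (x u)\<bar> \<le> C * \<phi> (x t)"
    using f_x_le_phi_x by blast
  have "((\<lambda>t. delay (\<lambda>u. f (x u)) t / \<phi> (x t)) \<longlongrightarrow> mass) at_top"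
  proof (rule delay_ratio_tendsto_mass[OF continuous_f_comp[OF x_cont] C(2)])
    fix s :: real assume s: "0 \<le> s"
    have "filterlim (\<lambda>t. t - s) at_top at_top"
      using filterlim_tendsto_add_at_top[OF tendsto_const[of "- s"] filterlim_ident] by simp
    from filterlim_compose[OF f_asymp filterlim_compose[OF x_at_top this]]
    have "((\<lambda>t. f (x (t - s)) / \<phi> (x (t - s)) * (\<phi> (x (t - s)) / \<phi> (x t))) \<longlongrightarrow> 1 * 1) at_top"
      by (rule tendsto_mult[OF _ phi_x_shift[OF s]])
    moreover have "f (x (t - s)) / \<phi> (x (t - s)) * (\<phi> (x (t - s)) / \<phi> (x t)) = f (x (t - s)) / \<phi> (x t)" for t
      using phx[of "t - s"] by simp
    ultimately show "((\<lambda>t. f (x (t - s)) / \<phi> (x t)) \<longlongrightarrow> 1) at_top" by (simp only: mult_1)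
  qed (use phx in auto)
  from tendsto_mult[OF this filterlim_compose[OF phi_over_f x_at_top]]
  have "((\<lambda>t. delay (\<lambda>u. f (x u)) t / \<phi> (x t) * (\<phi> (x t) / f (x t))) \<longlongrightarrow> mass) at_top" by simp
  moreover have "delay (\<lambda>u. f (x u)) t / \<phi> (x t) * (\<phi> (x t) / f (x t)) = delay (\<lambda>u. f (x u)) t / f (x t)" for t
    using phx[of t] by simp
  ultimately show ?thesis by (simp only:)
qed

text \<open>By the chain rule \<open>F (x t)\<close> has derivative
  \<open>delay (\<lambda>u. f (x u)) t / f (x t)\<close> off the atoms for large \<open>t\<close>.
  Being Lipschitz on bounded intervals, it is recovered from this derivative, whose limit is
  averaged.\<close>

lemma F_x_asymptotics: "((\<lambda>t. integral {1..x t} (\<lambda>u. 1 / f u) / t) \<longlongrightarrow> mass) at_top"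
proof -
  define F where "F y = integral {1..y} (\<lambda>u. 1 / f u)" for y
  obtain c where c: "0 < c" "\<And>u. 0 \<le> u \<Longrightarrow> c \<le> f u" using f_bounded_below by blast
  have fc: "continuous_on S (\<lambda>u. 1 / f u)" for S
    using f_pos by (intro continuous_on_divide continuous_on_const continuous_on_subset[OF f_cont]) (auto simp: less_le)
  have Fder: "(F has_real_derivative 1 / f y) (at y)" if y: "1 < y" for y
  proof -
    have "(F has_real_derivative 1 / f y) (at y within {1..y+1})"
      unfolding F_def[abs_def] using y by (intro integral_has_real_derivative fc) auto
    moreover have "at y within {1..y+1} = at y"
      using y by (intro at_within_interior) (simp add: interior_atLeastAtMost_real)
    ultimately show ?thesis by simp
  qed
  have Flip: "\<bar>F b - F a\<bar> \<le> 1 / c * (b - a)" if ab: "1 \<le> a" "a \<le> b" for a b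
  proof -
    have "F a + integral {a..b} (\<lambda>u. 1 / f u) = F b"
      unfolding F_def by (intro Henstock_Kurzweil_Integration.integral_combine ab integrable_continuous_real fc)
    moreover have "norm (integral {a..b} (\<lambda>u. 1 / f u)) \<le> 1 / c * measure lborel {a..b}"
    proof (intro has_integral_bound_real[OF _ finite.emptyI integrable_integral] integrable_continuous_real fc)
      fix u assume "u \<in> {a..b} - {}"
      then show "norm (1 / f u) \<le> 1 / c"
        using c(2)[of u] c(1) ab by (simp add: frac_le)
    qed (use c in auto)
    ultimately show ?thesis using ab by simp
  qed
  \<comment> \<open>Any threshold above 1 would do: \<open>integral {1..y}\<close> is 0 for
    \<open>y < 1\<close>, so the derivative formula \<open>Fder\<close> is valid only beyond
    1.\<close>
  have "\<forall>\<^sub>F t in at_top. 2 \<le> x t" using x_at_top by (simp add: filterlim_at_top)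
  then obtain T0 where T0: "\<And>t. t \<ge> T0 \<Longrightarrow> 2 \<le> x t" by (auto simp: eventually_at_top_linorder)
  define T where "T = max 1 T0"
  have T: "1 \<le> T" "\<And>t. t \<ge> T \<Longrightarrow> 2 \<le> x t" using T0 by (auto simp: T_def)
  have "((\<lambda>t. F (x t) / t) \<longlongrightarrow> mass) at_top"
  proof (rule tendsto_average[OF _ delay_over_f_x])
    fix s t assume st: "T \<le> s" "s \<le> t"
    show "((\<lambda>t. delay (\<lambda>u. f (x u)) t / f (x t)) has_integral F (x t) - F (x s)) {s..t}"
    proof (rule abs_cont_has_integral[OF st(2) _ negligible_atoms])
      obtain C where C: "C-lipschitz_on {0..t} x" using fixed_point_lipschitz[OF x_cont x_fixed] by blast
      have *: "\<bar>F (x q) - F (x p)\<bar> \<le> 1 / c * C * (q - p)" if pq: "s \<le> p" "p \<le> q" "q \<le> t" for p q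
      proof -
        have "\<bar>F (x q) - F (x p)\<bar> \<le> 1 / c * (x q - x p)"
          using pq st T(1) T(2)[of p] by (intro Flip x_mono) auto
        also have "\<dots> \<le> 1 / c * (C * (q - p))"
          using lipschitz_onD[OF C, of q p] pq st T(1) c by (intro mult_left_mono) (auto simp: dist_real_def)
        finally show ?thesis by simp
      qed
      have "(1 / c * C)-lipschitz_on {s..t} (\<lambda>r. F (x r))"
      proof (rule lipschitz_onI)
        fix p q assume "p \<in> {s..t}" "q \<in> {s..t}"
        then show "dist (F (x p)) (F (x q)) \<le> 1 / c * C * dist p q"
          using *[of p q] *[of q p] by (cases "p \<le> q") (auto simp: dist_real_def)
      qed (use c lipschitz_on_nonneg[OF C] in auto)
      then show "abs_cont_on_interval s t (\<lambda>r. F (x r))" by (rule abs_cont_on_interval_lipschitz)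
      fix r assume r: "r \<in> {s..t} - atoms"
      have "(x has_real_derivative delay (\<lambda>u. f (x u)) r) (at r)"
        using r st T(1) by (intro fixed_point_has_derivative x_cont x_fixed) auto
      from DERIV_chain2[OF Fder this] show "((\<lambda>r. F (x r)) has_real_derivative delay (\<lambda>u. f (x u)) r / f (x r)) (at r within {s..t})"
        using T(2)[of r] r st by (auto intro: has_field_derivative_at_within)
    qed
  qed
  then show ?thesis by (simp add: F_def)
qed

end

section \<open>The problem with measures on the half-line\<close>

text \<open>The measures are pushed forward to the real line, and \<open>f\<close> and \<open>\<psi>\<close> are extended by constants, so that
  solutions become fixed points of the Picard operator among continuous functions on all of \<open>\<real>\<close>.\<close>

locale delay_problem =
  fixes \<tau> :: real and \<mu>1 \<mu>2 :: "real measure" and f \<psi> :: "real \<Rightarrow> real"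
  assumes tau_pos: "0 < \<tau>"
    and borel1: "sets \<mu>1 = sets (restrict_space borel {0..})"
    and borel2: "sets \<mu>2 = sets (restrict_space borel {0..})"
    and finite1: "emeasure \<mu>1 {0..\<tau>} \<noteq> \<infinity>" and finite2: "emeasure \<mu>2 {0..} \<noteq> \<infinity>"
    and f_cont_nonneg: "continuous_on {0..} f"
    and f_pos_nonneg: "\<And>x. 0 \<le> x \<Longrightarrow> 0 < f x"
    and f_lipschitz: "local_lipschitz (UNIV :: real set) {0..} (\<lambda>_. f)"
    and psi_cont_Icc: "continuous_on {-\<tau>..0} \<psi>"
    and psi_pos_Icc: "\<And>t. t \<in> {-\<tau>..0} \<Longrightarrow> 0 < \<psi> t"
begin

definition f_ext :: "real \<Rightarrow> real" where "f_ext u = f (max u 0)"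

definition psi_ext :: "real \<Rightarrow> real" where "psi_ext t = \<psi> (max (-\<tau>) (min t 0))"

text \<open>Restriction precedes the push-forward because finiteness of \<open>\<mu>1\<close> is
  assumed only on \<open>{0..\<tau>}\<close>.\<close>

definition \<nu>\<^sub>1 :: "real measure" where "\<nu>\<^sub>1 = distr (restrict_space \<mu>1 {0..\<tau>}) borel (\<lambda>s. s)"

definition \<nu>\<^sub>2 :: "real measure" where "\<nu>\<^sub>2 = distr \<mu>2 borel (\<lambda>s. s)"

lemma space_mu: "space \<mu>1 = {0..}" "space \<mu>2 = {0..}"
  using sets_eq_imp_space_eq[OF borel1] sets_eq_imp_space_eq[OF borel2] by (simp_all add: space_restrict_space)

lemma Icc_sets: "{0..\<tau>} \<in> sets \<mu>1"
  unfolding borel1 sets_restrict_space by (rule image_eqI[of _ _ "{0..\<tau>}"]) auto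

lemma measurable_id1 [measurable]: "(\<lambda>s. s) \<in> borel_measurable (restrict_space \<mu>1 {0..\<tau>})"
proof -
  have "(\<lambda>s. s) \<in> borel_measurable (restrict_space borel {0..})"
    by (rule measurable_restrict_space1) simp
  then have "(\<lambda>s. s) \<in> borel_measurable \<mu>1" by (simp cong: measurable_cong_sets add: borel1)
  then show ?thesis by (rule measurable_restrict_space1)
qed

lemma measurable_id2 [measurable]: "(\<lambda>s. s) \<in> borel_measurable \<mu>2"
proof -
  have "(\<lambda>s. s) \<in> borel_measurable (restrict_space borel {0..})"
    by (rule measurable_restrict_space1) simp
  then show ?thesis by (simp cong: measurable_cong_sets add: borel2)
qed

lemma space_restrict_mu1: "space (restrict_space \<mu>1 {0..\<tau>}) = {0..\<tau>}"
  unfolding space_restrict_space space_mu by auto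

lemma emeasure_nu: "emeasure \<nu>\<^sub>1 UNIV = emeasure \<mu>1 {0..\<tau>}" "emeasure \<nu>\<^sub>2 UNIV = emeasure \<mu>2 {0..}"
proof -
  have "emeasure \<nu>\<^sub>1 UNIV = emeasure (restrict_space \<mu>1 {0..\<tau>}) ((\<lambda>s. s) -` UNIV \<inter> space (restrict_space \<mu>1 {0..\<tau>}))"
    unfolding \<nu>\<^sub>1_def by (rule emeasure_distr) auto
  also have "\<dots> = emeasure (restrict_space \<mu>1 {0..\<tau>}) {0..\<tau>}"
    unfolding space_restrict_mu1 vimage_UNIV by simp
  also have "\<dots> = emeasure \<mu>1 {0..\<tau>}"
    by (rule emeasure_restrict_space) (use Icc_sets in \<open>auto intro: sets.Int_space_eq2\<close>)
  finally show "emeasure \<nu>\<^sub>1 UNIV = emeasure \<mu>1 {0..\<tau>}" .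
  have "emeasure \<nu>\<^sub>2 UNIV = emeasure \<mu>2 ((\<lambda>s. s) -` UNIV \<inter> space \<mu>2)"
    unfolding \<nu>\<^sub>2_def by (rule emeasure_distr) auto
  then show "emeasure \<nu>\<^sub>2 UNIV = emeasure \<mu>2 {0..}"
    unfolding space_mu vimage_UNIV by simp
qed

lemma delay_kernel_nu: "delay_kernel \<tau> \<nu>\<^sub>1 \<nu>\<^sub>2"
proof (rule delay_kernel.intro)
  show "0 < \<tau>" by (rule tau_pos)
  show "sets \<nu>\<^sub>1 = sets borel" "sets \<nu>\<^sub>2 = sets borel" by (simp_all add: \<nu>\<^sub>1_def \<nu>\<^sub>2_def)
  show "finite_measure \<nu>\<^sub>1"
    by (rule finite_measureI) (use emeasure_nu finite1 in \<open>simp add: \<nu>\<^sub>1_def\<close>)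
  show "finite_measure \<nu>\<^sub>2"
    by (rule finite_measureI) (use emeasure_nu finite2 in \<open>simp add: \<nu>\<^sub>2_def\<close>)
  show "AE s in \<nu>\<^sub>1. 0 \<le> s \<and> s \<le> \<tau>"
    unfolding \<nu>\<^sub>1_def by (subst AE_distr_iff) (auto intro!: AE_I2 simp: space_restrict_mu1)
  show "AE s in \<nu>\<^sub>2. 0 \<le> s"
    unfolding \<nu>\<^sub>2_def by (subst AE_distr_iff) (auto intro!: AE_I2 simp: space_mu)
qed

sublocale delay_equation \<tau> \<nu>\<^sub>1 \<nu>\<^sub>2 f_ext psi_ext
proof (rule delay_equation.intro[OF delay_kernel_nu], rule delay_equation_axioms.intro)
  show "continuous_on UNIV f_ext"
    unfolding f_ext_def by (rule continuous_on_compose2[OF f_cont_nonneg]) (auto intro!: continuous_intros)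
  show "0 < f_ext u" for u by (simp add: f_ext_def f_pos_nonneg)
  show "\<exists>L\<ge>0. \<forall>u\<in>{-R..R}. \<forall>v\<in>{-R..R}. \<bar>f_ext u - f_ext v\<bar> \<le> L * \<bar>u - v\<bar>" for R
  proof -
    \<comment> \<open>Shrinking the time parameter to one point makes time and space compact, so
      that the local condition yields one constant; clamping at 0 is 1-Lipschitz and preserves
      it.\<close>
    have "local_lipschitz {0::real} {0..max R 0} (\<lambda>_. f)"
      by (rule local_lipschitz_subset[OF f_lipschitz]) auto
    then obtain L where "\<And>t::real. t \<in> {0} \<Longrightarrow> L-lipschitz_on {0..max R 0} f"
      by (rule local_lipschitz_compact_implies_lipschitz) auto
    then have L: "L-lipschitz_on {0..max R 0} f" by simp
    have "\<bar>f_ext u - f_ext v\<bar> \<le> L * \<bar>u - v\<bar>" if "u \<in> {-R..R}" "v \<in> {-R..R}" for u v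
    proof -
      have "\<bar>f_ext u - f_ext v\<bar> \<le> L * \<bar>max u 0 - max v 0\<bar>"
        using lipschitz_onD[OF L, of "max u 0" "max v 0"] that by (auto simp: f_ext_def dist_real_def)
      also have "\<dots> \<le> L * \<bar>u - v\<bar>"
        using lipschitz_on_nonneg[OF L] by (intro mult_left_mono) auto
      finally show ?thesis .
    qed
    then show ?thesis using lipschitz_on_nonneg[OF L] by blast
  qed
  show "continuous_on UNIV psi_ext"
    unfolding psi_ext_def using tau_pos
    by (intro continuous_on_compose2[OF psi_cont_Icc]) (auto intro!: continuous_intros)
  show "0 < psi_ext t" for t unfolding psi_ext_def using tau_pos by (intro psi_pos_Icc) auto
qed

lemma ennreal_mass: "ennreal mass = emeasure \<mu>1 {0..\<tau>} + emeasure \<mu>2 {0..}"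
proof -
  have "ennreal mass = ennreal (measure \<nu>\<^sub>1 UNIV) + ennreal (measure \<nu>\<^sub>2 UNIV)"
    unfolding mass_def by (rule ennreal_plus) simp_all
  also have "\<dots> = emeasure \<nu>\<^sub>1 UNIV + emeasure \<nu>\<^sub>2 UNIV"
    by (simp only: \<nu>1.emeasure_eq_measure \<nu>2.emeasure_eq_measure)
  finally show ?thesis by (simp only: emeasure_nu)
qed

text \<open>Every argument \<open>t - s\<close> that occurs is at least \<open>-\<tau>\<close>, so
  agreement there suffices. The two functions coincide for a fixed point, whereas for a given
  solution \<open>y\<close> is its constant continuation to the left.\<close>

lemma delay_rhs_eq_delay:
  assumes eq: "\<And>u. -\<tau> \<le> u \<Longrightarrow> y u = x u" and nonneg: "\<And>u. -\<tau> \<le> u \<Longrightarrow> 0 \<le> x u"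
    and y: "continuous_on UNIV y" and t: "0 \<le> t"
  shows "delay_rhs \<tau> \<mu>1 \<mu>2 f x t = delay (\<lambda>u. f_ext (y u)) t"
proof -
  have [measurable]: "(\<lambda>u. f_ext (y u)) \<in> borel_measurable borel"
    by (rule borel_measurable_continuous_onI[OF continuous_f_comp[OF y]])
  have fe: "f (x u) = f_ext (y u)" if "-\<tau> \<le> u" for u
    using eq[OF that] nonneg[OF that] by (simp add: f_ext_def)
  have "(LINT s:{0..\<tau>}|\<mu>1. f (x (t - s))) = (LINT s|restrict_space \<mu>1 {0..\<tau>}. f (x (t - s)))"
    using Icc_sets unfolding set_lebesgue_integral_def
    by (subst integral_restrict_space) (auto simp: space_mu Int_absorb2)
  also have "\<dots> = (LINT s|restrict_space \<mu>1 {0..\<tau>}. f_ext (y (t - s)))"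
    by (rule Bochner_Integration.integral_cong) (use t fe in \<open>auto simp: space_restrict_mu1\<close>)
  also have "\<dots> = (LINT s|\<nu>\<^sub>1. f_ext (y (t - s)))"
    unfolding \<nu>\<^sub>1_def by (subst integral_distr) auto
  finally have 1: "(LINT s:{0..\<tau>}|\<mu>1. f (x (t - s))) = (LINT s|\<nu>\<^sub>1. f_ext (y (t - s)))" .
  have "(LINT s:{0..t}|\<mu>2. f (x (t - s))) = (LINT s|\<mu>2. indicator {..t} s * f_ext (y (t - s)))"
    unfolding set_lebesgue_integral_def
    by (rule Bochner_Integration.integral_cong) (use t tau_pos fe in \<open>auto simp: space_mu indicator_def\<close>)
  also have "\<dots> = (LINT s|\<nu>\<^sub>2. indicator {..t} s * f_ext (y (t - s)))"
    unfolding \<nu>\<^sub>2_def by (subst integral_distr) auto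
  finally show ?thesis using 1 by (simp add: delay_rhs_def delay_def)
qed

lemma solution_if_fixed_point:
  assumes x: "continuous_on UNIV x" "picard x = x"
  shows "is_solution \<tau> \<mu>1 \<mu>2 f \<psi> x"
  unfolding is_solution_def
proof (intro conjI allI impI ballI)
  have pos: "0 < x t" for t using picard_pos[OF x(1), of t] x(2) by simp
  show "continuous_on {-\<tau>..} x" by (rule continuous_on_subset[OF x(1)]) simp
  show "0 \<le> x t" for t using pos[of t] by simp
  show "locally_abs_cont_nonneg x"
    unfolding locally_abs_cont_nonneg_def
    using fixed_point_lipschitz[OF x] abs_cont_on_interval_lipschitz by blast
  show "x t = \<psi> t" if "t \<in> {-\<tau>..0}" for t
    using picard_nonpos[of t x] x(2) that by (simp add: psi_ext_def)
  have "AE t in lborel. t \<notin> atoms"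
    by (intro AE_not_in countable_imp_null_set_lborel) (simp add: atoms_def \<nu>2.countable_support)
  then show "AE t in lborel. 0 < t \<longrightarrow> (x has_real_derivative delay_rhs \<tau> \<mu>1 \<mu>2 f x t) (at t)"
  proof eventually_elim
    case (elim t)
    then show ?case
      using fixed_point_has_derivative[OF x, of t] delay_rhs_eq_delay[OF refl less_imp_le[OF pos] x(1), of t]
      by auto
  qed
qed

text \<open>A solution is unrestricted to the left of \<open>-\<tau>\<close>, so it is replaced by
  \<open>z\<close>, constant there, which lies in the space on which fixed points are
  unique.\<close>

lemma fixed_point_if_solution:
  assumes y: "is_solution \<tau> \<mu>1 \<mu>2 f \<psi> y"
  defines "z \<equiv> \<lambda>t. y (max (-\<tau>) t)"
  shows "continuous_on UNIV z" "picard z = z"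
proof -
  have yc: "continuous_on {-\<tau>..} y" and y0: "\<And>t. -\<tau> \<le> t \<Longrightarrow> 0 \<le> y t"
    and yac: "\<And>b. 0 \<le> b \<Longrightarrow> abs_cont_on_interval 0 b y" and yi: "\<And>t. t \<in> {-\<tau>..0} \<Longrightarrow> y t = \<psi> t"
    and yd: "AE t in lborel. 0 < t \<longrightarrow> (y has_real_derivative delay_rhs \<tau> \<mu>1 \<mu>2 f y t) (at t)"
    using y by (auto simp: is_solution_def locally_abs_cont_nonneg_def)
  show zc: "continuous_on UNIV z"
    unfolding z_def by (rule continuous_on_compose2[OF yc]) (auto intro!: continuous_intros)
  from yd obtain N where
    yd': "\<And>t. t \<in> space lborel - N \<Longrightarrow> 0 < t \<longrightarrow> (y has_real_derivative delay_rhs \<tau> \<mu>1 \<mu>2 f y t) (at t)"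
    and N: "N \<in> null_sets lborel"
    by (rule AE_E3) (rule that)
  \<comment> \<open>The differential equation is asserted only for \<open>0 < t\<close>, while the
    integral runs over \<open>{0..t}\<close>; the endpoint 0 joins the exceptional set.\<close>
  have neg: "negligible (insert 0 N)"
    using null_sets_completionI[OF N] by (simp add: negligible_insert flip: negligible_iff_null_sets)
  show "picard z = z"
  proof
    fix t
    show "picard z t = z t"
    proof (cases "t \<le> 0")
      case True
      then show ?thesis using yi[of "max (-\<tau>) t"] tau_pos by (simp add: picard_nonpos psi_ext_def z_def)
    next
      case False
      have "(delay_rhs \<tau> \<mu>1 \<mu>2 f y has_integral y t - y 0) {0..t}"
        using False yd' by (intro abs_cont_has_integral[OF _ yac neg]) (auto intro: has_field_derivative_at_within)
      moreover have "delay_rhs \<tau> \<mu>1 \<mu>2 f y s = delay (\<lambda>u. f_ext (z u)) s" if "s \<in> {0..t}" for s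
        using that y0 by (intro delay_rhs_eq_delay zc) (auto simp: z_def)
      ultimately have "(delay (\<lambda>u. f_ext (z u)) has_integral y t - y 0) {0..t}"
        by (rule has_integral_eq[rotated])
      then have "integral {0..t} (delay (\<lambda>u. f_ext (z u))) = y t - y 0" by (rule integral_unique)
      moreover have "psi_ext 0 = y 0" using yi[of 0] tau_pos by (simp add: psi_ext_def)
      ultimately show ?thesis using False tau_pos by (simp add: picard_def z_def)
    qed
  qed
qed

lemma psi_ext_bounded: "\<exists>P. \<forall>t. psi_ext t \<le> P"
proof -
  obtain P where P: "\<And>u. u \<in> {-\<tau>..0} \<Longrightarrow> \<bar>psi_ext u\<bar> \<le> P" using continuous_bounded_Icc[OF psi_cont] by blast
  have "psi_ext t \<le> P" for t
  proof -
    have "psi_ext t = psi_ext (max (-\<tau>) (min t 0))" using tau_pos by (auto simp: psi_ext_def)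
    then show ?thesis using P[of "max (-\<tau>) (min t 0)"] tau_pos by simp
  qed
  then show ?thesis by blast
qed

end

theorem theorem4:
  fixes \<tau> M :: real and \<mu>1 \<mu>2 :: "real measure" and f \<phi> \<psi> :: "real \<Rightarrow> real"
  assumes tau: "0 < \<tau>"
    and borel1: "sets \<mu>1 = sets (restrict_space borel {0..})"
    and borel2: "sets \<mu>2 = sets (restrict_space borel {0..})"
    and M_def: "emeasure \<mu>1 {0..\<tau>} + emeasure \<mu>2 {0..} = ennreal M"
    and M_pos: "0 < M"
    and f_cont: "continuous_on {0..} f"
    and f_pos: "\<And>x. 0 \<le> x \<Longrightarrow> 0 < f x"
    and f_lipschitz: "local_lipschitz (UNIV :: real set) {0..} (\<lambda>_. f)"
    and phi: "\<phi> \<in> class_S"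
    and f_asymp: "((\<lambda>x. f x / \<phi> x) \<longlongrightarrow> 1) at_top"
    and psi_cont: "continuous_on {-\<tau>..0} \<psi>"
    and psi_pos: "\<And>t. t \<in> {-\<tau>..0} \<Longrightarrow> 0 < \<psi> t"
  shows "\<exists>x. is_solution \<tau> \<mu>1 \<mu>2 f \<psi> x \<and>
             (\<forall>y. is_solution \<tau> \<mu>1 \<mu>2 f \<psi> y \<longrightarrow> (\<forall>t\<ge>-\<tau>. y t = x t)) \<and>
             filterlim x at_top at_top \<and>
             ((\<lambda>t. F_int f (x t) / (M * t)) \<longlongrightarrow> 1) at_top"
proof -
  have "emeasure \<mu>1 {0..\<tau>} + emeasure \<mu>2 {0..} \<noteq> \<infinity>"
    unfolding M_def by simp
  then have "emeasure \<mu>1 {0..\<tau>} \<noteq> \<infinity>" "emeasure \<mu>2 {0..} \<noteq> \<infinity>"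
    by auto
  then interpret P: delay_problem \<tau> \<mu>1 \<mu>2 f \<psi>
    by unfold_locales (use assms in auto)
  obtain \<phi>' where "sublinear_function \<phi> \<phi>'"
    using phi by (auto simp: class_S_def sublinear_function_def)
  then interpret S: sublinear_function \<phi> \<phi>' .
  have mass: "P.mass = M"
    using P.ennreal_mass M_def M_pos P.mass_nonneg by simp
  have "continuous_on {0..} (\<lambda>u. f u / \<phi> u)"
    using S.phi_pos by (intro continuous_on_divide f_cont S.phi_cont) (auto simp: less_le)
  from bounded_above_of_tendsto[OF this f_asymp]
  obtain C where C: "0 < C" "\<And>u. 0 \<le> u \<Longrightarrow> f u \<le> C * \<phi> u"
    using S.phi_pos by (auto simp: divide_le_eq)
  obtain a where a: "0 \<le> a" "\<And>u. 0 \<le> u \<Longrightarrow> \<phi> u \<le> a * (1 + u)" using S.phi_linear_growth by blast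
  obtain B where B: "\<And>t. P.psi_ext t \<le> B" using P.psi_ext_bounded by blast
  have growth: "P.f_ext u \<le> C * a * (1 + u)" if "0 \<le> u" for u
  proof -
    have "P.f_ext u \<le> C * \<phi> u" using C(2)[OF that] that by (simp add: P.f_ext_def)
    also have "\<dots> \<le> C * (a * (1 + u))" using C(1) a(2)[OF that] by (intro mult_left_mono) auto
    finally show ?thesis by (simp add: mult.assoc)
  qed
  obtain x where x: "continuous_on UNIV x" "P.picard x = x"
    using P.fixed_point_exists[OF _ growth B] C(1) a(1) by auto
  have asymp: "((\<lambda>u. P.f_ext u / \<phi> u) \<longlongrightarrow> 1) at_top"
  proof (rule Lim_transform_eventually[OF f_asymp])
    show "\<forall>\<^sub>F u in at_top. f u / \<phi> u = P.f_ext u / \<phi> u"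
      using eventually_ge_at_top[of 0] by eventually_elim (simp add: P.f_ext_def)
  qed
  interpret A: delay_asymptotics \<tau> P.\<nu>\<^sub>1 P.\<nu>\<^sub>2 P.f_ext P.psi_ext \<phi> \<phi>' x
    by unfold_locales (use asymp mass M_pos x in auto)
  \<comment> \<open>Below 1 the oriented integral is negative while \<open>integral {1..v}\<close>
    is 0, so the two agree only from 1 on; \<open>x t\<close> stays above 1 eventually.\<close>
  have F: "F_int f v = integral {1..v} (\<lambda>u. 1 / P.f_ext u)" if v: "1 \<le> v" for v
  proof -
    have "set_integrable lborel {1..v} (\<lambda>u. 1 / f u)"
      using f_pos by (intro borel_integrable_atLeastAtMost' continuous_on_divide continuous_on_const
          continuous_on_subset[OF f_cont]) (auto simp: less_le)
    then have "F_int f v = integral {1..v} (\<lambda>u. 1 / f u)"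
      using interval_integral_eq_integral[OF v, of "\<lambda>u. 1 / f u"] by (simp add: F_int_def one_ereal_def)
    also have "\<dots> = integral {1..v} (\<lambda>u. 1 / P.f_ext u)"
      by (rule Henstock_Kurzweil_Integration.integral_cong) (simp add: P.f_ext_def)
    finally show ?thesis .
  qed
  have "\<forall>\<^sub>F t in at_top. 1 \<le> x t" using A.x_at_top by (simp add: filterlim_at_top)
  then have "\<forall>\<^sub>F t in at_top. integral {1..x t} (\<lambda>u. 1 / P.f_ext u) / t / M = F_int f (x t) / (M * t)"
    by eventually_elim (simp add: F)
  moreover have "((\<lambda>t. integral {1..x t} (\<lambda>u. 1 / P.f_ext u) / t / M) \<longlongrightarrow> M / M) at_top"
    using A.F_x_asymptotics M_pos unfolding mass by (intro tendsto_divide tendsto_const) auto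
  ultimately have lim: "((\<lambda>t. F_int f (x t) / (M * t)) \<longlongrightarrow> 1) at_top"
    using M_pos by (auto dest: Lim_transform_eventually)
  \<comment> \<open>The continuation of \<open>y\<close> is a fixed point and hence equals
    \<open>x\<close>; from \<open>-\<tau>\<close> on it is \<open>y\<close> itself.\<close>
  have "y t = x t" if y: "is_solution \<tau> \<mu>1 \<mu>2 f \<psi> y" and t: "-\<tau> \<le> t" for y t
    using fun_cong[OF P.fixed_point_unique[OF P.fixed_point_if_solution[OF y] x], of t] t by simp
  with P.solution_if_fixed_point[OF x] A.x_at_top lim show ?thesis by blast
qed

end
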